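(* Let $H$ be the five-dimensional complex solvable Leibniz algebra with basis $\{e_1,e_2,e_3,x_1,x_2\}$ and products $$[e_1,e_2]=e_3,\ [e_2,e_1]=-e_3,\ [e_1,x_1]=e_1,\ [x_1,e_1]=-e_1,\ [e_3,x_1]=e_3,\ [x_1,e_3]=-e_3,$$ $$[e_2,x_2]=e_2,\ [x_2,e_2]=-e_2,\ [e_3,x_2]=e_3,\ [x_2,e_3]=-e_3,$$ with nilradical $N=\langle e_1,e_2,e_3\rangle$. Let $\widehat H=H(\omega,l,r)$ be an extension of $H$ by the abelian algebra $\mathfrak h=\langle e_4\rangle$ (with $N\subseteq\ker l\cap\ker r$). Then $\widehat H$ is isomorphic to one of the following non-isomorphic algebras (basis $\{e_1,e_2,e_3,e_4,x_1,x_2\}$, $\delta\in\mathbb C$ a parameter): $\widehat H_1$: the products of $H$ together with $[e_4,x_1]=e_4$, $[x_2,e_1]=e_4$. $\widehat H_2$: the products of $H$ together with $[e_1,e_1]=e_4$, $[e_4,x_1]=2e_4$. $\widehat H_3$: $[e_1,e_2]=e_3+e_4$, $[e_2,e_1]=-e_3+e_4$, $[e_1,x_1]=e_1$, $[x_1,e_1]=-e_1$, $[e_3,x_1]=e_3$, $[x_1,e_3]=-e_3+e_4$, $[e_4,x_1]=e_4$, $[e_4,x_2]=e_4$, $[e_2,x_2]=e_2$, $[x_2,e_2]=-e_2$, $[e_3,x_2]=e_3$, $[x_2,e_3]=-e_3+e_4$. $\widehat H_4$: the products of $H$ with $[e_1,x_1]$ and $[x_1,e_1]$ replaced by $[e_1,x_1]=e_1+e_4$,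 $[x_1,e_1]=-e_1-e_4$, together with $[e_4,x_1]=e_4$, $[x_1,e_4]=-e_4$. $\widehat H_5(\delta)$: the products of $H$ with $[e_1,x_1]$ and $[x_1,e_1]$ replaced by $[e_1,x_1]=e_1+\delta e_4$, $[x_1,e_1]=-e_1-\delta e_4$, together with $[e_1,x_2]=e_4$, $[x_2,e_1]=-e_4$, $[e_4,x_1]=e_4$, $[x_1,e_4]=-e_4$. $\widehat H_6$: the products of $H$ together with $[e_1,e_3]=e_4$, $[e_3,e_1]=-e_4$, $[e_4,x_1]=2e_4$, $[x_1,e_4]=-2e_4$, $[e_4,x_2]=e_4$, $[x_2,e_4]=-e_4$.
   Context: All algebras are over $\mathbb C$; products of basis elements not listed are zero. A (right) Leibniz algebra is a vector space with a bilinear bracket satisfying $[[x,y],z]=[x,[y,z]]+[[x,z],y]$. The nilradical is the maximal nilpotent ideal. Abelian extension: let $\mathfrak g$ be a Leibniz algebra and $\mathfrak h$ a vector space regarded as an abelian algebra (zero bracket). A representation $(l,r)$ of $\mathfrak g$ on $\mathfrak h$ is a pair of linear maps $l,r:\mathfrak g\to\mathfrak{gl}(\mathfrak h)$ with $r_{[x,y]}=r_yr_x-r_xr_y$, $l_{[x,y]}=r_yl_x-l_xr_y$, $l_xl_y=-l_xr_y$ for all $x,y\in\mathfrak g$. A 2-cocycle with respect to $(l,r)$ is a bilinear map $\omega:\mathfrak g\times\mathfrak g\to\mathfrak h$ with $$\omega([x,y],z)-\omega(x,[y,z])-\omega([x,z],y)-l_x\omega(y,z)-r_y\omega(x,z)+r_z\omega(x,y)=0.$$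 Then $\mathfrak g(\omega,l,r)$ denotes the Leibniz algebra $\mathfrak g\oplus\mathfrak h$ with bracket $[x+a,y+b]=[x,y]+\omega(x,y)+l_xb+r_ya$ ($x,y\in\mathfrak g$, $a,b\in\mathfrak h$). Here $\ker l=\{x\in\mathfrak g: l_x=0\}$, and similarly for $r$.
   Formalization: The extension is assumed non-split (ω not a 2-coboundary) and (l,r) ≠ (0,0), since e.g. H ⊕ ℂ is not in the list; in Ĥ_3 the product [x_1,e_3] = -e_3+e_4 is corrected to -e_3-e_4, because the printed table violates the Leibniz identity. *)

theory Defs
  imports "HOL-Analysis.Analysis"
begin

section \<open>Leibniz algebras over the complex numbers\<close>

definition bilinear_map ::
  "(complex \<Rightarrow> 'a::ab_group_add \<Rightarrow> 'a) \<Rightarrow> (complex \<Rightarrow> 'b::ab_group_add \<Rightarrow> 'b) \<Rightarrow> ('a \<Rightarrow> 'a \<Rightarrow> 'b) \<Rightarrow> bool"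
  where "bilinear_map s t f \<longleftrightarrow>
    (\<forall>x. Vector_Spaces.linear s t (f x)) \<and> (\<forall>y. Vector_Spaces.linear s t (\<lambda>x. f x y))"

text \<open>Right Leibniz algebras: right multiplications are derivations.\<close>
definition leibniz_algebra ::
  "(complex \<Rightarrow> 'a::ab_group_add \<Rightarrow> 'a) \<Rightarrow> ('a \<Rightarrow> 'a \<Rightarrow> 'a) \<Rightarrow> bool"
  where "leibniz_algebra s br \<longleftrightarrow> vector_space s \<and> bilinear_map s s br \<and>
    (\<forall>x y z. br (br x y) z = br x (br y z) + br (br x z) y)"

definition leibniz_isomorphic ::
  "(complex \<Rightarrow> 'a::ab_group_add \<Rightarrow> 'a) \<Rightarrow> ('a \<Rightarrow> 'a \<Rightarrow> 'a) \<Rightarrow>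
   (complex \<Rightarrow> 'b::ab_group_add \<Rightarrow> 'b) \<Rightarrow> ('b \<Rightarrow> 'b \<Rightarrow> 'b) \<Rightarrow> bool"
  where "leibniz_isomorphic s br s' br' \<longleftrightarrow>
    (\<exists>\<phi>. Vector_Spaces.linear s s' \<phi> \<and> bij \<phi> \<and> (\<forall>x y. \<phi> (br x y) = br' (\<phi> x) (\<phi> y)))"

definition leibniz_ideal ::
  "(complex \<Rightarrow> 'a::ab_group_add \<Rightarrow> 'a) \<Rightarrow> ('a \<Rightarrow> 'a \<Rightarrow> 'a) \<Rightarrow> 'a set \<Rightarrow> bool"
  where "leibniz_ideal s br I \<longleftrightarrow> module.subspace s I \<and>
    (\<forall>x\<in>I. \<forall>y. br x y \<in> I \<and> br y x \<in> I)"

fun lower_central ::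
  "(complex \<Rightarrow> 'a::ab_group_add \<Rightarrow> 'a) \<Rightarrow> ('a \<Rightarrow> 'a \<Rightarrow> 'a) \<Rightarrow> 'a set \<Rightarrow> nat \<Rightarrow> 'a set"
  where
    "lower_central s br I 0 = I"
  | "lower_central s br I (Suc k) =
       module.span s {br x y | x y. x \<in> lower_central s br I k \<and> y \<in> I}"

definition nilpotent_ideal ::
  "(complex \<Rightarrow> 'a::ab_group_add \<Rightarrow> 'a) \<Rightarrow> ('a \<Rightarrow> 'a \<Rightarrow> 'a) \<Rightarrow> 'a set \<Rightarrow> bool"
  where "nilpotent_ideal s br I \<longleftrightarrow>
    leibniz_ideal s br I \<and> (\<exists>k. lower_central s br I k = {0})"

definition is_nilradical ::
  "(complex \<Rightarrow> 'a::ab_group_add \<Rightarrow> 'a) \<Rightarrow> ('a \<Rightarrow> 'a \<Rightarrow> 'a) \<Rightarrow> 'a set \<Rightarrow> bool"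
  where "is_nilradical s br N \<longleftrightarrow>
    nilpotent_ideal s br N \<and> (\<forall>I. nilpotent_ideal s br I \<longrightarrow> I \<subseteq> N)"


section \<open>Abelian extensions\<close>

definition leibniz_representation ::
  "(complex \<Rightarrow> 'a::ab_group_add \<Rightarrow> 'a) \<Rightarrow> ('a \<Rightarrow> 'a \<Rightarrow> 'a) \<Rightarrow> (complex \<Rightarrow> 'h::ab_group_add \<Rightarrow> 'h) \<Rightarrow>
   ('a \<Rightarrow> 'h \<Rightarrow> 'h) \<Rightarrow> ('a \<Rightarrow> 'h \<Rightarrow> 'h) \<Rightarrow> bool"
  where "leibniz_representation s br t l r \<longleftrightarrow>
    (\<forall>x. Vector_Spaces.linear t t (l x)) \<and> (\<forall>a. Vector_Spaces.linear s t (\<lambda>x. l x a)) \<and>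
    (\<forall>x. Vector_Spaces.linear t t (r x)) \<and> (\<forall>a. Vector_Spaces.linear s t (\<lambda>x. r x a)) \<and>
    (\<forall>x y a. r (br x y) a = r y (r x a) - r x (r y a)) \<and>
    (\<forall>x y a. l (br x y) a = r y (l x a) - l x (r y a)) \<and>
    (\<forall>x y a. l x (l y a) = - l x (r y a))"

definition leibniz_cocycle ::
  "(complex \<Rightarrow> 'a::ab_group_add \<Rightarrow> 'a) \<Rightarrow> ('a \<Rightarrow> 'a \<Rightarrow> 'a) \<Rightarrow> (complex \<Rightarrow> 'h::ab_group_add \<Rightarrow> 'h) \<Rightarrow>
   ('a \<Rightarrow> 'h \<Rightarrow> 'h) \<Rightarrow> ('a \<Rightarrow> 'h \<Rightarrow> 'h) \<Rightarrow> ('a \<Rightarrow> 'a \<Rightarrow> 'h) \<Rightarrow> bool"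
  where "leibniz_cocycle s br t l r \<omega> \<longleftrightarrow> bilinear_map s t \<omega> \<and>
    (\<forall>x y z. \<omega> (br x y) z - \<omega> x (br y z) - \<omega> (br x z) y
             - l x (\<omega> y z) - r y (\<omega> x z) + r z (\<omega> x y) = 0)"

text \<open>
  The cocycle is a coboundary exactly when the graph of some linear map from the algebra to
  the abelian part is a subalgebra of the extension, i.e. when the extension splits.
\<close>
definition leibniz_coboundary ::
  "(complex \<Rightarrow> 'a::ab_group_add \<Rightarrow> 'a) \<Rightarrow> ('a \<Rightarrow> 'a \<Rightarrow> 'a) \<Rightarrow> (complex \<Rightarrow> 'h::ab_group_add \<Rightarrow> 'h) \<Rightarrow>
   ('a \<Rightarrow> 'h \<Rightarrow> 'h) \<Rightarrow> ('a \<Rightarrow> 'h \<Rightarrow> 'h) \<Rightarrow> ('a \<Rightarrow> 'a \<Rightarrow> 'h) \<Rightarrow> bool"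
  where "leibniz_coboundary s br t l r \<omega> \<longleftrightarrow>
    (\<exists>f. Vector_Spaces.linear s t f \<and> (\<forall>x y. \<omega> x y = f (br x y) - l x (f y) - r y (f x)))"

definition action_kernel :: "('a \<Rightarrow> 'h::zero \<Rightarrow> 'h) \<Rightarrow> 'a set"
  where "action_kernel l = {x. \<forall>a. l x a = 0}"

definition ext_scale ::
  "(complex \<Rightarrow> 'a \<Rightarrow> 'a) \<Rightarrow> (complex \<Rightarrow> 'h \<Rightarrow> 'h) \<Rightarrow> complex \<Rightarrow> 'a \<times> 'h \<Rightarrow> 'a \<times> 'h"
  where "ext_scale s t c u = (s c (fst u), t c (snd u))"

definition ext_bracket ::
  "('a \<Rightarrow> 'a \<Rightarrow> 'a) \<Rightarrow> ('a \<Rightarrow> 'a \<Rightarrow> 'h::plus) \<Rightarrow> ('a \<Rightarrow> 'h \<Rightarrow> 'h) \<Rightarrow> ('a \<Rightarrow> 'h \<Rightarrow> 'h) \<Rightarrow>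
   'a \<times> 'h \<Rightarrow> 'a \<times> 'h \<Rightarrow> 'a \<times> 'h"
  where "ext_bracket br \<omega> l r u v =
    (br (fst u) (fst v), \<omega> (fst u) (fst v) + l (fst u) (snd v) + r (fst v) (snd u))"


section \<open>Algebras given by a multiplication table\<close>

abbreviation bas :: "'b::finite \<Rightarrow> complex ^ 'b"
  where "bas i \<equiv> axis i 1"

definition table_bracket ::
  "('b::finite \<Rightarrow> 'b \<Rightarrow> complex ^ 'b) \<Rightarrow> complex ^ 'b \<Rightarrow> complex ^ 'b \<Rightarrow> complex ^ 'b"
  where "table_bracket p u v = (\<Sum>i\<in>UNIV. \<Sum>j\<in>UNIV. (u $ i * v $ j) *s p i j)"


section \<open>The algebra H\<close>

datatype h_index = E1 | E2 | E3 | X1 | X2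

lemma UNIV_h_index: "UNIV = {E1, E2, E3, X1, X2}"
  by (auto intro: h_index.exhaust)

instance h_index :: finite
  by standard (simp add: UNIV_h_index)

fun H_table :: "h_index \<Rightarrow> h_index \<Rightarrow> complex ^ h_index" where
  "H_table E1 E2 = bas E3"
| "H_table E2 E1 = - bas E3"
| "H_table E1 X1 = bas E1"
| "H_table X1 E1 = - bas E1"
| "H_table E3 X1 = bas E3"
| "H_table X1 E3 = - bas E3"
| "H_table E2 X2 = bas E2"
| "H_table X2 E2 = - bas E2"
| "H_table E3 X2 = bas E3"
| "H_table X2 E3 = - bas E3"
| "H_table _ _ = 0"

definition H_bracket :: "complex ^ h_index \<Rightarrow> complex ^ h_index \<Rightarrow> complex ^ h_index"
  where "H_bracket = table_bracket H_table"

definition H_N :: "(complex ^ h_index) set"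
  where "H_N = vec.span {bas E1, bas E2, bas E3}"


section \<open>The six-dimensional algebras\<close>

text \<open>
  The indices \<open>F1, F2, F3, F4, Y1, Y2\<close> stand for the basis vectors
  \<open>e1, e2, e3, e4, x1, x2\<close> of the extended algebras.
\<close>
datatype hat_index = F1 | F2 | F3 | F4 | Y1 | Y2

lemma UNIV_hat_index: "UNIV = {F1, F2, F3, F4, Y1, Y2}"
  by (auto intro: hat_index.exhaust)

instance hat_index :: finite
  by standard (simp add: UNIV_hat_index)

fun base_table :: "hat_index \<Rightarrow> hat_index \<Rightarrow> complex ^ hat_index" where
  "base_table F1 F2 = bas F3"
| "base_table F2 F1 = - bas F3"
| "base_table F1 Y1 = bas F1"
| "base_table Y1 F1 = - bas F1"
| "base_table F3 Y1 = bas F3"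
| "base_table Y1 F3 = - bas F3"
| "base_table F2 Y2 = bas F2"
| "base_table Y2 F2 = - bas F2"
| "base_table F3 Y2 = bas F3"
| "base_table Y2 F3 = - bas F3"
| "base_table _ _ = 0"

fun hat1_table :: "hat_index \<Rightarrow> hat_index \<Rightarrow> complex ^ hat_index" where
  "hat1_table F4 Y1 = bas F4"
| "hat1_table Y2 F1 = bas F4"
| "hat1_table i j = base_table i j"

fun hat2_table :: "hat_index \<Rightarrow> hat_index \<Rightarrow> complex ^ hat_index" where
  "hat2_table F1 F1 = bas F4"
| "hat2_table F4 Y1 = 2 *s bas F4"
| "hat2_table i j = base_table i j"

text \<open>
  The sign of \<open>e4\<close> in the product of \<open>x1\<close> and \<open>e3\<close> is forced by the Leibniz identity for
  \<open>x1, e1, e2\<close>: since \<open>[[x1,e1],e2] = -[e1,e2] = -e3-e4\<close>, \<open>[[x1,e2],e1] = 0\<close> and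
  \<open>[x1,e4] = 0\<close>, one needs \<open>[x1,e3] = -e3-e4\<close>; with \<open>+e4\<close> the table would
  not define a Leibniz algebra (lemma \<open>hat3_sign\<close> below).
\<close>
fun hat3_table :: "hat_index \<Rightarrow> hat_index \<Rightarrow> complex ^ hat_index" where
  "hat3_table F1 F2 = bas F3 + bas F4"
| "hat3_table F2 F1 = - bas F3 + bas F4"
| "hat3_table Y1 F3 = - bas F3 - bas F4"
| "hat3_table F4 Y1 = bas F4"
| "hat3_table F4 Y2 = bas F4"
| "hat3_table Y2 F3 = - bas F3 + bas F4"
| "hat3_table i j = base_table i j"

fun hat4_table :: "hat_index \<Rightarrow> hat_index \<Rightarrow> complex ^ hat_index" where
  "hat4_table F1 Y1 = bas F1 + bas F4"
| "hat4_table Y1 F1 = - bas F1 - bas F4"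
| "hat4_table F4 Y1 = bas F4"
| "hat4_table Y1 F4 = - bas F4"
| "hat4_table i j = base_table i j"

fun hat5_table :: "complex \<Rightarrow> hat_index \<Rightarrow> hat_index \<Rightarrow> complex ^ hat_index" where
  "hat5_table \<delta> F1 Y1 = bas F1 + \<delta> *s bas F4"
| "hat5_table \<delta> Y1 F1 = - bas F1 - \<delta> *s bas F4"
| "hat5_table \<delta> F1 Y2 = bas F4"
| "hat5_table \<delta> Y2 F1 = - bas F4"
| "hat5_table \<delta> F4 Y1 = bas F4"
| "hat5_table \<delta> Y1 F4 = - bas F4"
| "hat5_table \<delta> i j = base_table i j"

fun hat6_table :: "hat_index \<Rightarrow> hat_index \<Rightarrow> complex ^ hat_index" where
  "hat6_table F1 F3 = bas F4"
| "hat6_table F3 F1 = - bas F4"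
| "hat6_table F4 Y1 = 2 *s bas F4"
| "hat6_table Y1 F4 = - (2 *s bas F4)"
| "hat6_table F4 Y2 = bas F4"
| "hat6_table Y2 F4 = - bas F4"
| "hat6_table i j = base_table i j"

datatype hat_name = Hat1 | Hat2 | Hat3 | Hat4 | Hat5 complex | Hat6

fun hat_table :: "hat_name \<Rightarrow> hat_index \<Rightarrow> hat_index \<Rightarrow> complex ^ hat_index" where
  "hat_table Hat1 = hat1_table"
| "hat_table Hat2 = hat2_table"
| "hat_table Hat3 = hat3_table"
| "hat_table Hat4 = hat4_table"
| "hat_table (Hat5 \<delta>) = hat5_table \<delta>"
| "hat_table Hat6 = hat6_table"

definition hat_bracket ::
  "hat_name \<Rightarrow> complex ^ hat_index \<Rightarrow> complex ^ hat_index \<Rightarrow> complex ^ hat_index"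
  where "hat_bracket n = table_bracket (hat_table n)"


section \<open>Consistency of the definitions\<close>

lemma bilinear_table_bracket: "bilinear_map (*s) (*s) (table_bracket p)"
  unfolding bilinear_map_def table_bracket_def Vector_Spaces.linear_def
    module_hom_def module_hom_axioms_def
  by (auto simp: vec.vector_space_axioms vec.module_axioms vec_eq_iff sum_distrib_left
      sum.distrib[symmetric] algebra_simps intro!: sum.cong)

lemma H_bracket_nth:
  "H_bracket u v $ E1 = u$E1 * v$X1 - u$X1 * v$E1"
  "H_bracket u v $ E2 = u$E2 * v$X2 - u$X2 * v$E2"
  "H_bracket u v $ E3 = u$E1 * v$E2 - u$E2 * v$E1 + u$E3 * v$X1 - u$X1 * v$E3
                        + u$E3 * v$X2 - u$X2 * v$E3"
  "H_bracket u v $ X1 = 0"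
  "H_bracket u v $ X2 = 0"
  by (simp_all add: H_bracket_def table_bracket_def UNIV_h_index axis_def)

lemma h_vec_eq_iff:
  "u = v \<longleftrightarrow> u$E1 = v$E1 \<and> u$E2 = v$E2 \<and> u$E3 = v$E3 \<and> u$X1 = v$X1 \<and> u$X2 = v$X2"
  for u v :: "complex ^ h_index"
  by (metis (full_types) h_index.exhaust vec_eq_iff)

lemma hat_vec_eq_iff:
  "u = v \<longleftrightarrow> u$F1 = v$F1 \<and> u$F2 = v$F2 \<and> u$F3 = v$F3 \<and> u$F4 = v$F4 \<and> u$Y1 = v$Y1 \<and> u$Y2 = v$Y2"
  for u v :: "complex ^ hat_index"
  by (metis (full_types) hat_index.exhaust vec_eq_iff)

lemma leibniz_algebra_H: "leibniz_algebra (*s) H_bracket"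
  unfolding leibniz_algebra_def
proof (intro conjI allI)
  show "bilinear_map (*s) (*s) H_bracket"
    unfolding H_bracket_def by (rule bilinear_table_bracket)
qed (simp_all add: vec.vector_space_axioms h_vec_eq_iff H_bracket_nth algebra_simps)

lemma hat_bracket_nth:
  "hat_bracket n u v $ F1 = u$F1 * v$Y1 - u$Y1 * v$F1"
  "hat_bracket n u v $ F2 = u$F2 * v$Y2 - u$Y2 * v$F2"
  "hat_bracket n u v $ F3 = u$F1 * v$F2 - u$F2 * v$F1 + u$F3 * v$Y1 - u$Y1 * v$F3
                            + u$F3 * v$Y2 - u$Y2 * v$F3"
  "hat_bracket n u v $ F4 = (case n of
      Hat1 \<Rightarrow> u$F4 * v$Y1 + u$Y2 * v$F1
    | Hat2 \<Rightarrow> u$F1 * v$F1 + 2 * (u$F4 * v$Y1)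
    | Hat3 \<Rightarrow> u$F1 * v$F2 + u$F2 * v$F1 - u$Y1 * v$F3 + u$Y2 * v$F3 + u$F4 * v$Y1 + u$F4 * v$Y2
    | Hat4 \<Rightarrow> u$F1 * v$Y1 - u$Y1 * v$F1 + u$F4 * v$Y1 - u$Y1 * v$F4
    | Hat5 \<delta> \<Rightarrow> \<delta> * (u$F1 * v$Y1 - u$Y1 * v$F1) + u$F1 * v$Y2 - u$Y2 * v$F1
                + u$F4 * v$Y1 - u$Y1 * v$F4
    | Hat6 \<Rightarrow> u$F1 * v$F3 - u$F3 * v$F1 + 2 * (u$F4 * v$Y1 - u$Y1 * v$F4)
              + u$F4 * v$Y2 - u$Y2 * v$F4)"
  "hat_bracket n u v $ Y1 = 0"
  "hat_bracket n u v $ Y2 = 0"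
  by (cases n; simp add: hat_bracket_def table_bracket_def UNIV_hat_index axis_def algebra_simps)+

lemma leibniz_algebra_hat: "leibniz_algebra (*s) (hat_bracket n)"
  unfolding leibniz_algebra_def
proof (intro conjI allI)
  show "bilinear_map (*s) (*s) (hat_bracket n)"
    unfolding hat_bracket_def by (rule bilinear_table_bracket)
  fix x y z
  show "hat_bracket n (hat_bracket n x y) z =
        hat_bracket n x (hat_bracket n y z) + hat_bracket n (hat_bracket n x z) y"
    by (cases n) (simp_all add: hat_vec_eq_iff hat_bracket_nth algebra_simps)
qed (simp add: vec.vector_space_axioms)

lemma hat3_sign:
  assumes "leibniz_algebra s br"
    and "br x1 e1 = - e1" "br x1 e2 = 0" "br x1 e4 = 0" "br e1 e2 = e3 + e4"
  shows "br x1 e3 = - e3 - e4"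
proof -
  have lr: "Vector_Spaces.linear s s (br x1)" "\<And>y. Vector_Spaces.linear s s (\<lambda>x. br x y)"
    using assms(1) by (auto simp: leibniz_algebra_def bilinear_map_def)
  interpret L: Vector_Spaces.linear s s "br x1" by (rule lr)
  interpret R: Vector_Spaces.linear s s "\<lambda>x. br x e1" by (rule lr)
  interpret R': Vector_Spaces.linear s s "\<lambda>x. br x e2" by (rule lr)
  have "br (br x1 e1) e2 = br x1 (br e1 e2) + br (br x1 e2) e1"
    using assms(1) unfolding leibniz_algebra_def by blast
  then have "- (e3 + e4) = br x1 e3"
    using assms R.zero R'.neg[of e1] L.add[of e3 e4] by simp
  then show ?thesis by simp
qed

lemma H_N_eq: "H_N = {v. v$X1 = 0 \<and> v$X2 = 0}"
proof
  have "vec.subspace {v :: complex ^ h_index. v$X1 = 0 \<and> v$X2 = 0}"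
    by (auto simp: vec.subspace_def)
  then show "H_N \<subseteq> {v. v$X1 = 0 \<and> v$X2 = 0}"
    unfolding H_N_def by (intro vec.span_minimal) (auto simp: axis_def)
  show "{v. v$X1 = 0 \<and> v$X2 = 0} \<subseteq> H_N"
  proof
    fix v :: "complex ^ h_index"
    assume v: "v \<in> {v. v$X1 = 0 \<and> v$X2 = 0}"
    have "v = v$E1 *s bas E1 + v$E2 *s bas E2 + v$E3 *s bas E3"
      using v by (simp add: h_vec_eq_iff axis_def)
    moreover have "\<dots> \<in> H_N"
      unfolding H_N_def by (intro vec.span_add vec.span_scale vec.span_base) auto
    ultimately show "v \<in> H_N" by simp
  qed
qed

lemma H_N_nilradical: "is_nilradical (*s) H_bracket H_N"
  unfolding is_nilradical_def
proof (intro conjI allI impI)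
  have ideal: "leibniz_ideal (*s) H_bracket H_N"
    unfolding leibniz_ideal_def
    by (auto simp: H_N_def H_N_eq[unfolded H_N_def] H_bracket_nth)
       (auto simp: vec.subspace_def)
  have sub1: "lower_central (*s) H_bracket H_N 1 \<subseteq> {v. v$E1 = 0 \<and> v$E2 = 0 \<and> v$X1 = 0 \<and> v$X2 = 0}"
    unfolding One_nat_def lower_central.simps
    by (rule vec.span_minimal) (auto simp: H_N_eq H_bracket_nth vec.subspace_def)
  have zero: "H_bracket x y = 0" if "x \<in> lower_central (*s) H_bracket H_N 1" "y \<in> H_N" for x y
    using subsetD[OF sub1 that(1)] that(2) by (simp add: h_vec_eq_iff H_bracket_nth H_N_eq)
  have "{H_bracket x y |x y. x \<in> lower_central (*s) H_bracket H_N 1 \<and> y \<in> H_N} \<subseteq> {0}"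
    using zero by blast
  then have "lower_central (*s) H_bracket H_N (Suc 1) \<subseteq> {0}"
    unfolding lower_central.simps(2)[of _ _ _ 1] by (rule vec.span_minimal) (rule vec.subspace_single_0)
  moreover have "0 \<in> lower_central (*s) H_bracket H_N (Suc 1)"
    unfolding lower_central.simps(2)[of _ _ _ 1] by (rule vec.span_zero)
  ultimately show "nilpotent_ideal (*s) H_bracket H_N"
    unfolding nilpotent_ideal_def using ideal by blast
next
  fix I assume I: "nilpotent_ideal (*s) H_bracket I"
  then obtain k where k: "lower_central (*s) H_bracket I k = {0}"
    and id: "\<And>x y. x \<in> I \<Longrightarrow> H_bracket y x \<in> I"
    by (auto simp: nilpotent_ideal_def leibniz_ideal_def)
  have step: "H_bracket w v \<in> lower_central (*s) H_bracket I (Suc m)"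
    if "w \<in> lower_central (*s) H_bracket I m" "v \<in> I" for w v m
    using that by (auto intro!: vec.span_base)
  show "I \<subseteq> H_N"
  proof
    fix v assume v: "v \<in> I"
    have "v$X1 = 0"
    proof (rule ccontr)
      assume a: "v$X1 \<noteq> 0"
      have "\<exists>w \<in> lower_central (*s) H_bracket I m. w$X1 = 0 \<and> w$E1 \<noteq> 0" for m
      proof (induction m)
        case 0
        show ?case using id[OF v, of "bas E1"] a
          by (intro bexI[of _ "H_bracket (bas E1) v"]) (auto simp: H_bracket_nth axis_def)
      next
        case (Suc m)
        then obtain w where "w \<in> lower_central (*s) H_bracket I m" "w$X1 = 0" "w$E1 \<noteq> 0"
          by blast
        then show ?case using step[OF _ v] a
          by (intro bexI[of _ "H_bracket w v"]) (auto simp: H_bracket_nth)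
      qed
      from this[of k] k show False by auto
    qed
    moreover have "v$X2 = 0"
    proof (rule ccontr)
      assume a: "v$X2 \<noteq> 0"
      have "\<exists>w \<in> lower_central (*s) H_bracket I m. w$X2 = 0 \<and> w$E2 \<noteq> 0" for m
      proof (induction m)
        case 0
        show ?case using id[OF v, of "bas E2"] a
          by (intro bexI[of _ "H_bracket (bas E2) v"]) (auto simp: H_bracket_nth axis_def)
      next
        case (Suc m)
        then obtain w where "w \<in> lower_central (*s) H_bracket I m" "w$X2 = 0" "w$E2 \<noteq> 0"
          by blast
        then show ?case using step[OF _ v] a
          by (intro bexI[of _ "H_bracket w v"]) (auto simp: H_bracket_nth)
      qed
      from this[of k] k show False by auto
    qed
    ultimately show "v \<in> H_N" by (simp add: H_N_eq)
  qed
qed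

lemma leibniz_identity_ext:
  assumes "leibniz_algebra s br" "leibniz_representation s br t l r" "leibniz_cocycle s br t l r \<omega>"
  defines "B \<equiv> ext_bracket br \<omega> l r"
  shows "B (B u v) w = B u (B v w) + B (B u w) v"
proof -
  have id: "br (br x y) z = br x (br y z) + br (br x z) y" for x y z
    using assms(1) unfolding leibniz_algebra_def by blast
  have add: "l x (a + b) = l x a + l x b" "r x (a + b) = r x a + r x b" for x a b
    using assms(2) by (auto simp: leibniz_representation_def Vector_Spaces.linear_iff)
  have rep: "r (br x y) a = r y (r x a) - r x (r y a)"
    "l (br x y) a = r y (l x a) - l x (r y a)" "l x (l y a) = - l x (r y a)" for x y a
    using assms(2) unfolding leibniz_representation_def by blast+
  have coc0: "\<omega> (br x y) z - \<omega> x (br y z) - \<omega> (br x z) y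
             - l x (\<omega> y z) - r y (\<omega> x z) + r z (\<omega> x y) = 0" for x y z
    using assms(3) unfolding leibniz_cocycle_def by blast
  have coc: "r z (\<omega> x y) = \<omega> x (br y z) + \<omega> (br x z) y + l x (\<omega> y z) + r y (\<omega> x z) - \<omega> (br x y) z"
    for x y z
    using coc0[of x y z] by (simp only: algebra_simps add_eq_0_iff add_0)
  have "fst (B (B u v) w) = fst (B u (B v w) + B (B u w) v)"
    by (simp add: B_def ext_bracket_def id[of "fst u" "fst v" "fst w"])
  moreover have "snd (B (B u v) w) = snd (B u (B v w) + B (B u w) v)"
    by (simp add: B_def ext_bracket_def add rep coc[of "fst w" "fst u" "fst v"])
  ultimately show ?thesis by (rule prod_eqI)
qed

end

theory Submission
  imports Defs
begin

text \<open>
  The nilradical acts trivially on the line \<open>\<langle>e4\<rangle>\<close>, so the two actions are weights \<open>\<sigma>\<close> (left) and \<open>\<rho>\<close>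
  (right) of the torus \<open>\<langle>x1, x2\<rangle>\<close>, and the representation axioms force \<open>\<sigma> = 0\<close> or \<open>\<sigma> = -\<rho>\<close>.
  The torus acts trivially on cohomology, so only the entries of the cocycle of total weight \<open>\<rho>\<close>
  matter. This leaves finitely many \<open>\<rho>\<close>. For \<open>\<sigma> = 0\<close> the nonzero classes sit at \<open>(1,0)\<close>, \<open>(2,0)\<close>,
  \<open>(1,1)\<close> and their mirror images under \<open>e1 \<leftrightarrow> e2\<close>; for \<open>\<sigma> = -\<rho>\<close> the cocycle is alternating and the
  classes sit at \<open>(1,0)\<close> (a plane of classes, hence the parameter \<open>\<delta>\<close>), \<open>(2,1)\<close> and their mirror images.
\<close>

section \<open>Scalar extensions of \<open>H\<close>\<close>

text \<open>The components of the weight are the eigenvalues of right multiplication by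
  \<open>x1\<close> and \<open>x2\<close> on the basis vector.\<close>

fun wt :: "h_index \<Rightarrow> complex \<times> complex" where
  "wt E1 = (1, 0)"
| "wt E2 = (0, 1)"
| "wt E3 = (1, 1)"
| "wt X1 = (0, 0)"
| "wt X2 = (0, 0)"

definition functional :: "(h_index \<Rightarrow> complex) \<Rightarrow> complex ^ h_index \<Rightarrow> complex"
  where "functional f v = (\<Sum>i\<in>UNIV. f i * v $ i)"

text \<open>A linear form that vanishes on the nilradical. For \<open>\<sigma>\<close> and
  \<open>\<rho>\<close> it is the scalar by which an element of \<open>H\<close> acts on the line
  from the left and from the right.\<close>

definition torus_functional :: "complex \<times> complex \<Rightarrow> complex ^ h_index \<Rightarrow> complex"
  where "torus_functional a v = fst a * v$X1 + snd a * v$X2"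

lemma functional_eq:
  "functional f v = f E1 * v$E1 + f E2 * v$E2 + f E3 * v$E3 + f X1 * v$X1 + f X2 * v$X2"
  by (simp add: functional_def UNIV_h_index)

lemma linear_functional: "Vector_Spaces.linear (*s) (*) (functional f)"
  by (simp add: Vector_Spaces.linear_iff functional_eq algebra_simps vec.vector_space_axioms
      vector_space_over_itself.vector_space_axioms)

lemma functional_bas [simp]: "functional f (bas i) = f i"
  by (cases i) (simp_all add: functional_eq axis_def)

lemma torus_functional_bas:
  "torus_functional a (bas E1) = 0" "torus_functional a (bas E2) = 0"
  "torus_functional a (bas E3) = 0" "torus_functional a (bas X1) = fst a"
  "torus_functional a (bas X2) = snd a"
  by (simp_all add: torus_functional_def axis_def)

lemma H_bracket_bas: "H_bracket (bas i) (bas j) = H_table i j"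
  by (cases i; cases j; simp add: h_vec_eq_iff H_bracket_nth axis_def)

definition coboundary ::
  "complex \<times> complex \<Rightarrow> complex \<times> complex \<Rightarrow> (h_index \<Rightarrow> complex) \<Rightarrow>
   complex ^ h_index \<Rightarrow> complex ^ h_index \<Rightarrow> complex"
  where "coboundary \<sigma> \<rho> f x y = functional f (H_bracket x y)
    - torus_functional \<sigma> x * functional f y - torus_functional \<rho> y * functional f x"

lemma bilinear_expansion:
  fixes w :: "complex ^ h_index \<Rightarrow> complex ^ h_index \<Rightarrow> complex"
  assumes "bilinear_map (*s) (*) w"
  shows "w x y = (\<Sum>i\<in>UNIV. \<Sum>j\<in>UNIV. x$i * y$j * w (bas i) (bas j))"
proof -
  have add: "w (a + b) c = w a c + w b c" "w c (a + b) = w c a + w c b"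
    and sc: "w (k *s a) c = k * w a c" "w c (k *s a) = k * w c a" for a b c k
    using assms by (auto simp: bilinear_map_def Vector_Spaces.linear_iff)
  have e: "v = v$E1 *s bas E1 + v$E2 *s bas E2 + v$E3 *s bas E3 + v$X1 *s bas X1 + v$X2 *s bas X2"
    for v :: "complex ^ h_index"
    by (simp add: h_vec_eq_iff axis_def)
  show ?thesis
    by (subst e[of x], subst e[of y]) (simp add: add sc UNIV_h_index algebra_simps)
qed

lemma bilinear_coboundary: "bilinear_map (*s) (*) (coboundary \<sigma> \<rho> f)"
  by (simp add: bilinear_map_def Vector_Spaces.linear_iff coboundary_def functional_eq H_bracket_nth
      torus_functional_def algebra_simps vec.vector_space_axioms
      vector_space_over_itself.vector_space_axioms)

text \<open>Each nonzero pair rules out at most one value of \<open>s\<close>, and the complex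
  numbers are infinite. The resulting torus element \<open>x1 + s x2\<close> separates finitely many
  weights from 0.\<close>

lemma generic_torus_element:
  fixes P :: "(complex \<times> complex) set"
  assumes "finite P"
  obtains s where "\<And>\<mu>. \<mu> \<in> P \<Longrightarrow> \<mu> \<noteq> 0 \<Longrightarrow> fst \<mu> + s * snd \<mu> \<noteq> 0"
proof -
  \<comment> \<open>For \<open>snd \<mu> = 0\<close> the quotient is 0 by convention. This only
    removes one more candidate for \<open>s\<close>.\<close>
  have "finite ((\<lambda>\<mu>. - fst \<mu> / snd \<mu>) ` P)"
    using assms by simp
  then obtain s where s: "s \<notin> (\<lambda>\<mu>. - fst \<mu> / snd \<mu>) ` P"
    using ex_new_if_finite[OF infinite_UNIV_char_0] by blast
  have "fst \<mu> + s * snd \<mu> \<noteq> 0" if "\<mu> \<in> P" "\<mu> \<noteq> 0" for \<mu>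
  proof
    assume z: "fst \<mu> + s * snd \<mu> = 0"
    then have "snd \<mu> \<noteq> 0"
      using that(2) by (auto simp: prod_eq_iff)
    with z have "s = - fst \<mu> / snd \<mu>"
      by (simp add: field_simps add_eq_0_iff2)
    with s that(1) show False by blast
  qed
  then show ?thesis by (rule that)
qed

section \<open>Complex-valued cocycles and their weight decomposition\<close>

locale scalar_cocycle =
  fixes \<sigma> \<rho> :: "complex \<times> complex" and w :: "complex ^ h_index \<Rightarrow> complex ^ h_index \<Rightarrow> complex"
  assumes bilinear: "bilinear_map (*s) (*) w"
    and cocycle: "w (H_bracket x y) z - w x (H_bracket y z) - w (H_bracket x z) y
      - torus_functional \<sigma> x * w y z - torus_functional \<rho> y * w x z + torus_functional \<rho> z * w x y = 0"
begin

lemma add_left: "w (a + b) c = w a c + w b c" and add_right: "w c (a + b) = w c a + w c b"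
  and scale_left: "w (k *s a) c = k * w a c" and scale_right: "w c (k *s a) = k * w c a"
  using bilinear by (auto simp: bilinear_map_def Vector_Spaces.linear_iff)

lemma minus_left: "w (- a) c = - w a c" and minus_right: "w c (- a) = - w c a"
  using scale_left[of "-1"] scale_right[of _ "-1"] by simp_all

lemma zero_left: "w 0 c = 0" and zero_right: "w c 0 = 0"
  using scale_left[of 0] scale_right[of _ 0] by simp_all

lemmas bilinear_simps =
  add_left add_right scale_left scale_right minus_left minus_right zero_left zero_right

lemma cocycle_bas:
  "w (H_table i j) (bas k) - w (bas i) (H_table j k) - w (H_table i k) (bas j)
    - torus_functional \<sigma> (bas i) * w (bas j) (bas k) - torus_functional \<rho> (bas j) * w (bas i) (bas k)
    + torus_functional \<rho> (bas k) * w (bas i) (bas j) = 0"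
  using cocycle[of "bas i" "bas j" "bas k"] by (simp add: H_bracket_bas)

text \<open>
  For an element \<open>t\<close> of the torus and \<open>\<phi> = w(-, t)\<close>, the cocycle identity with last argument \<open>t\<close>
  reads \<open>d\<phi> = (\<mu> - \<rho>)(t) w\<close> on pairs of total weight \<open>\<mu>\<close>. Hence \<open>w\<close> is cohomologous to its part
  of weight \<open>\<rho>\<close>.
\<close>
lemma weight_reduction:
  obtains f where "\<And>i j. w (bas i) (bas j) =
    coboundary \<sigma> \<rho> f (bas i) (bas j) + (if wt i + wt j = \<rho> then w (bas i) (bas j) else 0)"
proof -
  let ?P = "(\<lambda>(i, j). wt i + wt j - \<rho>) ` UNIV"
  obtain s where s: "\<And>\<mu>. \<mu> \<in> ?P \<Longrightarrow> \<mu> \<noteq> 0 \<Longrightarrow> fst \<mu> + s * snd \<mu> \<noteq> 0"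
    by (rule generic_torus_element[of ?P]) auto
  define ev where "ev \<mu> = fst \<mu> + s * snd \<mu>" for \<mu> :: "complex \<times> complex"
  have nz: "ev (wt i + wt j - \<rho>) \<noteq> 0" if "wt i + wt j \<noteq> \<rho>" for i j
    unfolding ev_def using that by (intro s) (auto simp: image_iff)
  define t :: "complex ^ h_index" where "t = bas X1 + s *s bas X2"
  \<comment> \<open>The value 0 at weight \<open>\<rho>\<close> makes the coboundary of
    \<open>f\<close> vanish on all pairs of total weight \<open>\<rho>\<close>, so it leaves that
    part of \<open>w\<close> untouched.\<close>
  define f where "f m = (if wt m = \<rho> then 0 else w (bas m) t / ev (wt m - \<rho>))" for m
  \<comment> \<open>\<open>X1\<close> has weight 0, so a single basis vector counts as a pair with
    \<open>X1\<close>.\<close>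
  have nz': "ev (wt m - \<rho>) \<noteq> 0" if "wt m \<noteq> \<rho>" for m
    using nz[of m X1] that by (simp add: zero_prod_def[symmetric])
  have brt: "H_bracket (bas i) t = ev (wt i) *s bas i" for i
    by (cases i) (simp_all add: t_def ev_def h_vec_eq_iff H_bracket_nth axis_def)
  have key: "w (H_table i j) t - torus_functional \<sigma> (bas i) * w (bas j) t
      - torus_functional \<rho> (bas j) * w (bas i) t = ev (wt i + wt j - \<rho>) * w (bas i) (bas j)" for i j
  proof -
    have "torus_functional \<rho> t = ev \<rho>"
      by (simp add: torus_functional_def t_def ev_def axis_def)
    moreover have "ev (wt i + wt j - \<rho>) = ev (wt i) + ev (wt j) - ev \<rho>"
      by (simp add: ev_def algebra_simps)
    ultimately show ?thesis
      using cocycle[of "bas i" "bas j" t]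
      by (simp add: brt H_bracket_bas scale_left scale_right) (simp add: algebra_simps)
  qed
  have fe: "f m * ev (wt m - \<rho>) = w (bas m) t" if "wt m \<noteq> \<rho>" for m
    using nz'[OF that] that by (simp add: f_def)
  have f0: "f m = 0" if "wt m = \<rho>" for m
    using that by (simp add: f_def)
  have "ev (wt i + wt j - \<rho>) * coboundary \<sigma> \<rho> f (bas i) (bas j) =
     ev (wt i + wt j - \<rho>) * w (bas i) (bas j)" if n: "wt i + wt j \<noteq> \<rho>" for i j
  proof -
    \<comment> \<open>A product of basis vectors is 0 or, up to sign, a basis vector of the same
      total weight, and the actions are nonzero only on torus vectors, which have weight 0. So all
      three terms of the coboundary share the denominator
      \<open>ev (wt i + wt j - \<rho>)\<close>.\<close>
    have a: "ev (wt i + wt j - \<rho>) * functional f (H_table i j) = w (H_table i j) t"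
      using n fe[of E1] fe[of E2] fe[of E3]
      by (cases i; cases j;
          simp add: functional_eq axis_def bilinear_simps mult.commute zero_prod_def[symmetric])
    have b: "ev (wt i + wt j - \<rho>) * (torus_functional \<sigma> (bas i) * f j) =
        torus_functional \<sigma> (bas i) * w (bas j) t"
      using n fe[of j]
      by (cases i; simp add: torus_functional_def axis_def zero_prod_def[symmetric] mult.commute mult.left_commute)
    have c: "ev (wt i + wt j - \<rho>) * (torus_functional \<rho> (bas j) * f i) =
        torus_functional \<rho> (bas j) * w (bas i) t"
      using n fe[of i]
      by (cases j; simp add: torus_functional_def axis_def zero_prod_def[symmetric] mult.commute mult.left_commute)
    show ?thesis
      by (simp add: coboundary_def H_bracket_bas right_diff_distrib a b c key[symmetric])
  qed
  then have 1: "w (bas i) (bas j) = coboundary \<sigma> \<rho> f (bas i) (bas j)" if "wt i + wt j \<noteq> \<rho>" for i j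
    using nz[OF that] that by (metis mult_left_cancel)
  have 2: "coboundary \<sigma> \<rho> f (bas i) (bas j) = 0" if "wt i + wt j = \<rho>" for i j
    using that f0[of i] f0[of j] f0[of E1] f0[of E2] f0[of E3]
    by (cases i; cases j;
        simp add: coboundary_def H_bracket_nth functional_eq torus_functional_def axis_def zero_prod_def[symmetric])
  show ?thesis
    by (rule that[of f]) (simp add: 1 2)
qed

end

text \<open>Since \<open>[y,y] = 0\<close> in \<open>H\<close>, all terms of the cocycle identity at
  \<open>(x, y, y)\<close> cancel except \<open>\<sigma>(x) w(y,y)\<close>. Polarization gives
  skew-symmetry.\<close>

lemma (in scalar_cocycle) alternating:
  assumes "\<sigma> \<noteq> 0"
  shows "w y y = 0" "w x y = - w y x"
proof -
  have alt: "w y y = 0" for y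
  proof -
    have "H_bracket y y = 0"
      by (simp add: h_vec_eq_iff H_bracket_nth algebra_simps)
    then have "torus_functional \<sigma> x * w y y = 0" for x
      using cocycle[of x y y] by (simp add: bilinear_simps)
    from this[of "bas X1"] this[of "bas X2"] assms show ?thesis
      by (auto simp: torus_functional_def axis_def prod_eq_iff)
  qed
  show "w y y = 0" by (rule alt)
  have "w x y + w y x = 0"
    using alt[of "x + y"] by (simp add: bilinear_simps alt[of x] alt[of y] add.commute)
  then show "w x y = - w y x" by (simp only: eq_neg_iff_add_eq_0)
qed

text \<open>With \<open>swap\<close>, precomposes with the automorphism of \<open>H\<close> exchanging \<open>e1, x1\<close> with \<open>e2, x2\<close>.\<close>
definition hat_embedding :: "bool \<Rightarrow> complex ^ h_index \<Rightarrow> complex \<Rightarrow> complex ^ hat_index"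
  where "hat_embedding swap x a = (\<chi> k. case k of
      F1 \<Rightarrow> if swap then x$E2 else x$E1
    | F2 \<Rightarrow> if swap then x$E1 else x$E2
    | F3 \<Rightarrow> if swap then - x$E3 else x$E3
    | F4 \<Rightarrow> a
    | Y1 \<Rightarrow> if swap then x$X2 else x$X1
    | Y2 \<Rightarrow> if swap then x$X1 else x$X2)"

definition cohomologous ::
  "complex \<times> complex \<Rightarrow> complex \<times> complex \<Rightarrow> (complex ^ h_index \<Rightarrow> complex ^ h_index \<Rightarrow> complex) \<Rightarrow>
   (complex ^ h_index \<Rightarrow> complex ^ h_index \<Rightarrow> complex) \<Rightarrow> bool"
  where "cohomologous \<sigma> \<rho> w v \<longleftrightarrow> (\<exists>f. \<forall>x y. w x y = coboundary \<sigma> \<rho> f x y + v x y)"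

text \<open>The factor \<open>c\<close> rescales \<open>e4\<close>. Only the coordinate
  \<open>F4\<close> is compared, because on the other coordinates all six tables agree with
  \<open>H\<close>.\<close>

definition realizes ::
  "complex \<times> complex \<Rightarrow> complex \<times> complex \<Rightarrow> (complex ^ h_index \<Rightarrow> complex ^ h_index \<Rightarrow> complex) \<Rightarrow>
   complex \<Rightarrow> bool \<Rightarrow> hat_name \<Rightarrow> bool"
  where "realizes \<sigma> \<rho> v c swap n \<longleftrightarrow> c \<noteq> 0 \<and> (\<forall>x y a b.
    c * v x y + torus_functional \<sigma> x * b + torus_functional \<rho> y * a =
      hat_bracket n (hat_embedding swap x a) (hat_embedding swap y b) $ F4)"

definition splits_or_realized ::
  "complex \<times> complex \<Rightarrow> complex \<times> complex \<Rightarrow> (complex ^ h_index \<Rightarrow> complex ^ h_index \<Rightarrow> complex) \<Rightarrow> bool"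
  where "splits_or_realized \<sigma> \<rho> w \<longleftrightarrow> cohomologous \<sigma> \<rho> w (\<lambda>x y. 0) \<or>
    (\<exists>v c swap n. cohomologous \<sigma> \<rho> w v \<and> realizes \<sigma> \<rho> v c swap n)"

section \<open>Classification of the cocycle classes by weight\<close>

context scalar_cocycle
begin

lemma cohomologous_shift:
  assumes "cohomologous \<sigma> \<rho> w v"
  shows "cohomologous \<sigma> \<rho> w (\<lambda>x y. v x y - coboundary \<sigma> \<rho> g x y)"
proof -
  obtain f where "\<And>x y. w x y = coboundary \<sigma> \<rho> f x y + v x y"
    using assms by (auto simp: cohomologous_def)
  then have "w x y = coboundary \<sigma> \<rho> (\<lambda>i. f i + g i) x y + (v x y - coboundary \<sigma> \<rho> g x y)" for x y
    by (simp add: coboundary_def functional_eq algebra_simps)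
  then show ?thesis by (auto simp: cohomologous_def)
qed

lemma cohomologous_weight_part:
  "cohomologous \<sigma> \<rho> w (\<lambda>x y. \<Sum>i\<in>UNIV. \<Sum>j\<in>UNIV.
    x$i * y$j * (if wt i + wt j = \<rho> then w (bas i) (bas j) else 0))"
proof -
  obtain f where f: "\<And>i j. w (bas i) (bas j) =
      coboundary \<sigma> \<rho> f (bas i) (bas j) + (if wt i + wt j = \<rho> then w (bas i) (bas j) else 0)"
    using weight_reduction by blast
  have "w x y = coboundary \<sigma> \<rho> f x y + (\<Sum>i\<in>UNIV. \<Sum>j\<in>UNIV.
    x$i * y$j * (if wt i + wt j = \<rho> then w (bas i) (bas j) else 0))" for x y
    unfolding bilinear_expansion[OF bilinear, of x y]
      bilinear_expansion[OF bilinear_coboundary, of _ _ _ x y] sum.distrib[symmetric]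
    by (intro sum.cong refl, subst f) (simp add: algebra_simps)
  then show ?thesis unfolding cohomologous_def by blast
qed

text \<open>The eight special cases are the nonzero sums of two weights of basis vectors; at any
  other \<open>\<rho>\<close> the weight part is empty. At \<open>(2,1)\<close>,
  \<open>(1,2)\<close> and \<open>(2,2)\<close> the cocycle identity kills every entry.\<close>

lemma classify_left_zero:
  assumes \<sigma>: "\<sigma> = 0" and \<rho>: "\<rho> \<noteq> 0"
  shows "splits_or_realized \<sigma> \<rho> w"
proof -
  note wp = cohomologous_weight_part[unfolded UNIV_h_index, simplified]
  note simps = torus_functional_bas bilinear_simps \<sigma>
  consider (10) "\<rho> = (1, 0)" | (01) "\<rho> = (0, 1)" | (20) "\<rho> = (2, 0)" | (02) "\<rho> = (0, 2)"
    | (11) "\<rho> = (1, 1)" | (21) "\<rho> = (2, 1)" | (12) "\<rho> = (1, 2)" | (22) "\<rho> = (2, 2)"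
    | (no) "\<rho> \<notin> {(1,0), (0,1), (2,0), (0,2), (1,1), (2,1), (1,2), (2,2)}"
    by blast
  then show ?thesis
  proof cases
    case 10
    let ?u = "w (bas X1) (bas E1)" and ?v = "w (bas X2) (bas E1)"
    have z: "w (bas E1) (bas X1) = 0" "w (bas E1) (bas X2) = 0"
      using cocycle_bas[of X1 E1 X1] cocycle_bas[of X1 E1 X2] by (simp_all add: simps 10)
    have "cohomologous \<sigma> \<rho> w (\<lambda>x y. ?u * x$X1 * y$E1 + ?v * x$X2 * y$E1)"
      using wp by (simp add: 10 z algebra_simps)
    \<comment> \<open>Without a left action, the coboundary of the coordinate form of
      \<open>e1\<close> is minus the entry at \<open>(x1, e1)\<close>. This entry can therefore be
      removed, and the one at \<open>(x2, e1)\<close> remains.\<close>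
    from cohomologous_shift[OF this, of "\<lambda>i. if i = E1 then - ?u else 0"]
    have coh: "cohomologous \<sigma> \<rho> w (\<lambda>x y. ?v * x$X2 * y$E1)"
      by (simp add: coboundary_def functional_eq H_bracket_nth torus_functional_def \<sigma> 10 algebra_simps)
    show ?thesis
    proof (cases "?v = 0")
      case False
      then have "realizes \<sigma> \<rho> (\<lambda>x y. ?v * x$X2 * y$E1) (1 / ?v) False Hat1"
        by (simp add: realizes_def hat_bracket_nth hat_embedding_def torus_functional_def \<sigma> 10)
      with coh show ?thesis unfolding splits_or_realized_def by blast
    qed (use coh in \<open>simp add: splits_or_realized_def\<close>)
  next
    case 01
    let ?u = "w (bas X1) (bas E2)" and ?v = "w (bas X2) (bas E2)"
    have z: "w (bas E2) (bas X1) = 0" "w (bas E2) (bas X2) = 0"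
      using cocycle_bas[of X2 E2 X1] cocycle_bas[of X2 E2 X2] by (simp_all add: simps 01)
    have "cohomologous \<sigma> \<rho> w (\<lambda>x y. ?u * x$X1 * y$E2 + ?v * x$X2 * y$E2)"
      using wp by (simp add: 01 z algebra_simps)
    from cohomologous_shift[OF this, of "\<lambda>i. if i = E2 then - ?v else 0"]
    have coh: "cohomologous \<sigma> \<rho> w (\<lambda>x y. ?u * x$X1 * y$E2)"
      by (simp add: coboundary_def functional_eq H_bracket_nth torus_functional_def \<sigma> 01 algebra_simps)
    show ?thesis
    proof (cases "?u = 0")
      case False
      then have "realizes \<sigma> \<rho> (\<lambda>x y. ?u * x$X1 * y$E2) (1 / ?u) True Hat1"
        by (simp add: realizes_def hat_bracket_nth hat_embedding_def torus_functional_def \<sigma> 01)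
      with coh show ?thesis unfolding splits_or_realized_def by blast
    qed (use coh in \<open>simp add: splits_or_realized_def\<close>)
  next
    case 20
    let ?u = "w (bas E1) (bas E1)"
    have coh: "cohomologous \<sigma> \<rho> w (\<lambda>x y. ?u * x$E1 * y$E1)"
      using wp by (simp add: 20 algebra_simps)
    show ?thesis
    proof (cases "?u = 0")
      case False
      then have "realizes \<sigma> \<rho> (\<lambda>x y. ?u * x$E1 * y$E1) (1 / ?u) False Hat2"
        by (simp add: realizes_def hat_bracket_nth hat_embedding_def torus_functional_def \<sigma> 20)
      with coh show ?thesis unfolding splits_or_realized_def by blast
    qed (use coh in \<open>simp add: splits_or_realized_def\<close>)
  next
    case 02
    let ?u = "w (bas E2) (bas E2)"
    have coh: "cohomologous \<sigma> \<rho> w (\<lambda>x y. ?u * x$E2 * y$E2)"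
      using wp by (simp add: 02 algebra_simps)
    show ?thesis
    proof (cases "?u = 0")
      case False
      then have "realizes \<sigma> \<rho> (\<lambda>x y. ?u * x$E2 * y$E2) (1 / ?u) True Hat2"
        by (simp add: realizes_def hat_bracket_nth hat_embedding_def torus_functional_def \<sigma> 02)
      with coh show ?thesis unfolding splits_or_realized_def by blast
    qed (use coh in \<open>simp add: splits_or_realized_def\<close>)
  next
    case 11
    let ?u = "w (bas E1) (bas E2)" and ?v = "w (bas E2) (bas E1)"
    \<comment> \<open>The coboundary of \<open>?d\<close> times the coordinate form of
      \<open>e3\<close> carries the skew part on \<open>e1, e2\<close>. Subtracting it turns both
      entries into the mean \<open>?s\<close>, and the entries at \<open>(x1, e3)\<close> and
      \<open>(x2, e3)\<close> into \<open>-?s\<close> and \<open>?s\<close>, the pattern of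
      \<open>Hat3\<close>.\<close>
    let ?s = "(?u + ?v) / 2" and ?d = "(?u - ?v) / 2"
    have z: "w (bas E3) (bas X1) = 0" "w (bas E3) (bas X2) = 0"
      "w (bas X1) (bas E3) = - ?u" "w (bas X2) (bas E3) = ?v"
      using cocycle_bas[of X1 E3 X1] cocycle_bas[of X1 E3 X2] cocycle_bas[of X1 E1 E2]
        cocycle_bas[of X2 E1 E2] by (simp_all add: simps 11 add_eq_0_iff2)
    have "cohomologous \<sigma> \<rho> w (\<lambda>x y. ?u * x$E1 * y$E2 + ?v * x$E2 * y$E1 - ?u * x$X1 * y$E3 + ?v * x$X2 * y$E3)"
      using wp by (simp add: 11 z algebra_simps)
    note cohomologous_shift[OF this, of "\<lambda>i. if i = E3 then ?d else 0"]
    also have "(\<lambda>x y. ?u * x$E1 * y$E2 + ?v * x$E2 * y$E1 - ?u * x$X1 * y$E3 + ?v * x$X2 * y$E3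
        - coboundary \<sigma> \<rho> (\<lambda>i. if i = E3 then ?d else 0) x y) =
      (\<lambda>x y. ?s * (x$E1 * y$E2 + x$E2 * y$E1 - x$X1 * y$E3 + x$X2 * y$E3))"
      by (intro ext)
        (simp add: coboundary_def functional_eq H_bracket_nth torus_functional_def \<sigma> 11 field_simps)
    finally have coh: "cohomologous \<sigma> \<rho> w
      (\<lambda>x y. ?s * (x$E1 * y$E2 + x$E2 * y$E1 - x$X1 * y$E3 + x$X2 * y$E3))" .
    show ?thesis
    proof (cases "?s = 0")
      case False
      have "realizes \<sigma> \<rho> (\<lambda>x y. s * (x$E1 * y$E2 + x$E2 * y$E1 - x$X1 * y$E3 + x$X2 * y$E3)) (1 / s) False Hat3"
        if "s \<noteq> 0" for s
        using that
        by (simp add: realizes_def hat_bracket_nth hat_embedding_def torus_functional_def \<sigma> 11 algebra_simps)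
      note this[OF False]
      with coh show ?thesis unfolding splits_or_realized_def by blast
    qed (use coh in \<open>simp add: splits_or_realized_def\<close>)
  next
    case 21
    \<comment> \<open>One instance of the identity makes the two entries equal, the next makes them
      opposite.\<close>
    have z: "w (bas E3) (bas E1) = w (bas E1) (bas E3)"
      using cocycle_bas[of X1 E1 E3] by (simp add: simps 21)
    have "w (bas E1) (bas E3) = 0"
      using cocycle_bas[of E1 E1 E2] by (simp add: simps 21 z)
    then show ?thesis using wp z by (simp add: splits_or_realized_def 21)
  next
    case 12
    have z: "w (bas E3) (bas E2) = w (bas E2) (bas E3)"
      using cocycle_bas[of X2 E2 E3] by (simp add: simps 12)
    have "w (bas E2) (bas E3) = 0"
      using cocycle_bas[of E2 E1 E2] by (simp add: simps 12 z)
    then show ?thesis using wp z by (simp add: splits_or_realized_def 12)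
  next
    case 22
    have "w (bas E3) (bas E3) = 0"
      using cocycle_bas[of E3 E1 E2] by (simp add: simps 22)
    then show ?thesis using wp by (simp add: splits_or_realized_def 22)
  next
    case no
    then have "(0, 0) \<noteq> \<rho>" "(1, 0) \<noteq> \<rho>" "(0, 1) \<noteq> \<rho>" "(2, 0) \<noteq> \<rho>" "(0, 2) \<noteq> \<rho>"
      "(1, 1) \<noteq> \<rho>" "(2, 1) \<noteq> \<rho>" "(1, 2) \<noteq> \<rho>" "(2, 2) \<noteq> \<rho>"
      using \<rho> by (auto simp: zero_prod_def)
    then show ?thesis using wp by (simp add: splits_or_realized_def)
  qed
qed

text \<open>Here \<open>w\<close> is alternating, so the weights \<open>(2,0)\<close>,
  \<open>(0,2)\<close> and \<open>(2,2)\<close>, carried only by diagonal pairs, drop out and five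
  cases are left.\<close>

lemma classify_antisymmetric:
  assumes \<sigma>: "\<sigma> = - \<rho>" and \<rho>: "\<rho> \<noteq> 0"
  shows "splits_or_realized \<sigma> \<rho> w"
proof -
  note wp = cohomologous_weight_part[unfolded UNIV_h_index, simplified]
  note simps = torus_functional_bas bilinear_simps \<sigma>
  have "\<sigma> \<noteq> 0"
    using \<sigma> \<rho> by simp
  note alt = alternating(1)[OF this] and skew = alternating(2)[OF this]
  note skews = skew[of "bas E2" "bas E1"] skew[of "bas E3" "bas E1"] skew[of "bas E3" "bas E2"]
    skew[of "bas X1" "bas E1"] skew[of "bas X1" "bas E2"] skew[of "bas X1" "bas E3"]
    skew[of "bas X2" "bas E1"] skew[of "bas X2" "bas E2"] skew[of "bas X2" "bas E3"]
  consider (10) "\<rho> = (1, 0)" | (01) "\<rho> = (0, 1)"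
    | (11) "\<rho> = (1, 1)" | (21) "\<rho> = (2, 1)" | (12) "\<rho> = (1, 2)"
    | (no) "\<rho> \<notin> {(1,0), (0,1), (1,1), (2,1), (1,2)}"
    by blast
  then show ?thesis
  proof cases
    case 10
    let ?u = "w (bas E1) (bas X1)" and ?v = "w (bas E1) (bas X2)"
    let ?N = "\<lambda>x y. ?u * (x$E1 * y$X1 - x$X1 * y$E1) + ?v * (x$E1 * y$X2 - x$X2 * y$E1)"
    have coh: "cohomologous \<sigma> \<rho> w ?N"
      using wp by (simp add: 10 skews algebra_simps)
    \<comment> \<open>Rescaling \<open>e4\<close> multiplies \<open>?u\<close> and \<open>?v\<close>
      by the same factor, so only the ratio counts: \<open>(1:0)\<close> is \<open>Hat4\<close> and
      \<open>(\<delta>:1)\<close> is \<open>Hat5 \<delta>\<close>.\<close>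
    consider "?u = 0" "?v = 0" | "?u \<noteq> 0" "?v = 0" | "?v \<noteq> 0" by blast
    then show ?thesis
    proof cases
      case 1
      then show ?thesis using coh by (simp add: splits_or_realized_def)
    next
      case 2
      then have "realizes \<sigma> \<rho> ?N (1 / ?u) False Hat4"
        by (simp add: realizes_def hat_bracket_nth hat_embedding_def torus_functional_def \<sigma> 10)
      with coh show ?thesis unfolding splits_or_realized_def by blast
    next
      case 3
      then have "realizes \<sigma> \<rho> ?N (1 / ?v) False (Hat5 (?u / ?v))"
        by (simp add: realizes_def hat_bracket_nth hat_embedding_def torus_functional_def \<sigma> 10 field_simps)
      with coh show ?thesis unfolding splits_or_realized_def by blast
    qed
  next
    case 01
    let ?u = "w (bas E2) (bas X2)" and ?v = "w (bas E2) (bas X1)"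
    let ?N = "\<lambda>x y. ?u * (x$E2 * y$X2 - x$X2 * y$E2) + ?v * (x$E2 * y$X1 - x$X1 * y$E2)"
    have coh: "cohomologous \<sigma> \<rho> w ?N"
      using wp by (simp add: 01 skews algebra_simps)
    consider "?u = 0" "?v = 0" | "?u \<noteq> 0" "?v = 0" | "?v \<noteq> 0" by blast
    then show ?thesis
    proof cases
      case 1
      then show ?thesis using coh by (simp add: splits_or_realized_def)
    next
      case 2
      then have "realizes \<sigma> \<rho> ?N (1 / ?u) True Hat4"
        by (simp add: realizes_def hat_bracket_nth hat_embedding_def torus_functional_def \<sigma> 01)
      with coh show ?thesis unfolding splits_or_realized_def by blast
    next
      case 3
      then have "realizes \<sigma> \<rho> ?N (1 / ?v) True (Hat5 (?u / ?v))"
        by (simp add: realizes_def hat_bracket_nth hat_embedding_def torus_functional_def \<sigma> 01 field_simps)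
      with coh show ?thesis unfolding splits_or_realized_def by blast
    qed
  next
    case 11
    let ?u = "w (bas E1) (bas E2)"
    have z: "w (bas E3) (bas X1) = 0" "w (bas E3) (bas X2) = 0"
      using cocycle_bas[of E1 E2 X1] cocycle_bas[of E1 E2 X2] by (simp_all add: simps 11)
    have "cohomologous \<sigma> \<rho> w (\<lambda>x y. ?u * (x$E1 * y$E2 - x$E2 * y$E1))"
      using wp by (simp add: 11 skews z algebra_simps)
    \<comment> \<open>With \<open>\<sigma> = -\<rho>\<close> the torus terms in the coboundary of
      the coordinate form of \<open>e3\<close> cancel. What is left is exactly the form on
      \<open>e1, e2\<close>, so the class is zero.\<close>
    from cohomologous_shift[OF this, of "\<lambda>i. if i = E3 then ?u else 0"]
    have "cohomologous \<sigma> \<rho> w (\<lambda>x y. 0)"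
      by (simp add: coboundary_def functional_eq H_bracket_nth torus_functional_def \<sigma> 11 algebra_simps)
    then show ?thesis by (simp add: splits_or_realized_def)
  next
    case 21
    let ?u = "w (bas E1) (bas E3)"
    let ?N = "\<lambda>x y. ?u * (x$E1 * y$E3 - x$E3 * y$E1)"
    have coh: "cohomologous \<sigma> \<rho> w ?N"
      using wp by (simp add: 21 skews algebra_simps)
    show ?thesis
    proof (cases "?u = 0")
      case False
      then have "realizes \<sigma> \<rho> ?N (1 / ?u) False Hat6"
        by (simp add: realizes_def hat_bracket_nth hat_embedding_def torus_functional_def \<sigma> 21 algebra_simps)
      with coh show ?thesis unfolding splits_or_realized_def by blast
    qed (use coh in \<open>simp add: splits_or_realized_def\<close>)
  next
    case 12
    let ?u = "w (bas E2) (bas E3)"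
    let ?N = "\<lambda>x y. ?u * (x$E2 * y$E3 - x$E3 * y$E2)"
    have coh: "cohomologous \<sigma> \<rho> w ?N"
      using wp by (simp add: 12 skews algebra_simps)
    show ?thesis
    proof (cases "?u = 0")
      case False
      \<comment> \<open>The minus sign comes from the swap, which sends \<open>e3 = [e1,e2]\<close>
        to \<open>[e2,e1] = -e3\<close>.\<close>
      then have "realizes \<sigma> \<rho> ?N (- 1 / ?u) True Hat6"
        by (simp add: realizes_def hat_bracket_nth hat_embedding_def torus_functional_def \<sigma> 12 algebra_simps)
      with coh show ?thesis unfolding splits_or_realized_def by blast
    qed (use coh in \<open>simp add: splits_or_realized_def\<close>)
  next
    case no
    then have "(0, 0) \<noteq> \<rho>" "(1, 0) \<noteq> \<rho>" "(0, 1) \<noteq> \<rho>"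
      "(1, 1) \<noteq> \<rho>" "(2, 1) \<noteq> \<rho>" "(1, 2) \<noteq> \<rho>"
      using \<rho> by (auto simp: zero_prod_def)
    then show ?thesis using wp by (simp add: splits_or_realized_def alt cong: if_cong)
  qed
qed

end

section \<open>Reduction to scalar extensions\<close>

lemma one_dimensional_coordinate:
  fixes sh :: "complex \<Rightarrow> 'h::ab_group_add \<Rightarrow> 'h"
  assumes "vector_space sh" "e \<noteq> 0" "module.span sh {e} = UNIV"
  obtains \<kappa> where "Vector_Spaces.linear sh (*) \<kappa>" "\<And>a. sh (\<kappa> a) e = a" "\<And>k. \<kappa> (sh k e) = k"
proof -
  interpret vector_space sh by fact
  have "\<exists>k. sh k e = a" for a
    using assms(3) span_singleton[of e] by (metis UNIV_I imageE)
  then obtain \<kappa> where \<kappa>: "\<And>a. sh (\<kappa> a) e = a"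
    by metis
  have \<kappa>': "\<kappa> (sh k e) = k" for k
    using \<kappa>[of "sh k e"] assms(2) by (simp add: scale_cancel_right)
  have "\<kappa> (a + b) = \<kappa> a + \<kappa> b" for a b
    using \<kappa>'[of "\<kappa> a + \<kappa> b"] by (simp add: scale_left_distrib \<kappa>)
  moreover have "\<kappa> (sh k a) = k * \<kappa> a" for k a
    using \<kappa>'[of "k * \<kappa> a"] by (simp add: scale_scale[symmetric] \<kappa> del: scale_scale)
  ultimately have "Vector_Spaces.linear sh (*) \<kappa>"
    by (simp add: Vector_Spaces.linear_iff vector_space_axioms vector_space_over_itself.vector_space_axioms)
  then show ?thesis using that \<kappa> \<kappa>' by blast
qed

text \<open>Endomorphisms of a line are scalars, and \<open>x\<close> acts as its torus part since
  the difference lies in \<open>H_N\<close>. The weight consists of the scalars of \<open>x1\<close>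
  and \<open>x2\<close>.\<close>

lemma action_scalar:
  fixes sh :: "complex \<Rightarrow> 'h::ab_group_add \<Rightarrow> 'h"
  assumes "Vector_Spaces.linear sh (*) \<kappa>" "\<And>a. sh (\<kappa> a) e = a"
    and "\<And>x. Vector_Spaces.linear sh sh (l x)" "\<And>a. Vector_Spaces.linear (*s) sh (\<lambda>x. l x a)"
    and "H_N \<subseteq> action_kernel l"
  obtains \<sigma> where "\<And>x a. \<kappa> (l x a) = torus_functional \<sigma> x * \<kappa> a"
proof
  fix x a
  have \<kappa>: "\<kappa> (u + v) = \<kappa> u + \<kappa> v" "\<kappa> (sh k u) = k * \<kappa> u" for u v k
    using assms(1) by (auto simp: Vector_Spaces.linear_iff)
  have l1: "l x (sh k u) = sh k (l x u)" for x k u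
    using assms(3) by (auto simp: Vector_Spaces.linear_iff)
  have l2: "l (x + y) u = l x u + l y u" "l (k *s x) u = sh k (l x u)" for x y k u
    using assms(4) by (auto simp: Vector_Spaces.linear_iff)
  let ?n = "x - x$X1 *s bas X1 - x$X2 *s bas X2"
  have "?n \<in> H_N"
    by (simp add: H_N_eq axis_def)
  then have n: "l ?n a = 0"
    using assms(5) by (auto simp: action_kernel_def)
  have "l x a = l (?n + (x$X1 *s bas X1 + x$X2 *s bas X2)) a"
    by simp
  also have "\<dots> = sh (x$X1) (l (bas X1) a) + sh (x$X2) (l (bas X2) a)"
    unfolding l2(1)[of ?n] n by (simp add: l2)
  finally have "\<kappa> (l x a) = x$X1 * \<kappa> (l (bas X1) a) + x$X2 * \<kappa> (l (bas X2) a)"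
    by (simp add: \<kappa>)
  moreover have "\<kappa> (l y a) = \<kappa> a * \<kappa> (l y e)" for y
    using l1[of y "\<kappa> a" e] by (simp add: assms(2) \<kappa>)
  ultimately show "\<kappa> (l x a) =
      torus_functional (\<kappa> (l (bas X1) e), \<kappa> (l (bas X2) e)) x * \<kappa> a"
    by (simp add: torus_functional_def algebra_simps)
qed

lemma isomorphic_if_realized:
  fixes sh :: "complex \<Rightarrow> 'h::ab_group_add \<Rightarrow> 'h"
  assumes \<kappa>: "Vector_Spaces.linear sh (*) \<kappa>" "\<And>a. sh (\<kappa> a) e = a" "\<And>k. \<kappa> (sh k e) = k"
    and l: "\<And>x a. \<kappa> (l x a) = torus_functional \<sigma> x * \<kappa> a"
    and r: "\<And>x a. \<kappa> (r x a) = torus_functional \<rho> x * \<kappa> a"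
    and w: "\<And>x y. \<kappa> (\<omega> x y) = coboundary \<sigma> \<rho> f x y + v x y"
    and v: "realizes \<sigma> \<rho> v c swap n"
  shows "leibniz_isomorphic (ext_scale (*s) sh) (ext_bracket H_bracket \<omega> l r) (*s) (hat_bracket n)"
proof -
  interpret sh: vector_space sh
    using \<kappa>(1) by (simp add: Vector_Spaces.linear_iff)
  have \<kappa>_add: "\<kappa> (a + b) = \<kappa> a + \<kappa> b" and \<kappa>_sc: "\<kappa> (sh k a) = k * \<kappa> a" for a b k
    using \<kappa>(1) by (auto simp: Vector_Spaces.linear_iff)
  have \<kappa>_inj: "\<kappa> a = \<kappa> b \<Longrightarrow> a = b" for a b
    using \<kappa>(2) by metis
  have c: "c \<noteq> 0" and hom4: "c * v x y + torus_functional \<sigma> x * b + torus_functional \<rho> y * a =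
      hat_bracket n (hat_embedding swap x a) (hat_embedding swap y b) $ F4" for x y a b
    using v by (auto simp: realizes_def)
  \<comment> \<open>Subtracting \<open>f\<close> absorbs the coboundary, and \<open>c\<close>
    normalizes the remaining cocycle.\<close>
  define \<phi> where "\<phi> u = hat_embedding swap (fst u) (c * (\<kappa> (snd u) - functional f (fst u)))" for u
  have nth: "\<phi> u $ F1 = (if swap then fst u$E2 else fst u$E1)" "\<phi> u $ F2 = (if swap then fst u$E1 else fst u$E2)"
    "\<phi> u $ F3 = (if swap then - fst u$E3 else fst u$E3)" "\<phi> u $ F4 = c * (\<kappa> (snd u) - functional f (fst u))"
    "\<phi> u $ Y1 = (if swap then fst u$X2 else fst u$X1)" "\<phi> u $ Y2 = (if swap then fst u$X1 else fst u$X2)" for u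
    by (simp_all add: \<phi>_def hat_embedding_def)
  have "vector_space (ext_scale (*s) sh :: complex \<Rightarrow> (complex ^ h_index) \<times> 'h \<Rightarrow> _)"
    by standard (simp_all add: ext_scale_def prod_eq_iff algebra_simps sh.scale_right_distrib sh.scale_left_distrib)
  then have lin: "Vector_Spaces.linear (ext_scale (*s) sh) (*s) \<phi>"
    by (simp add: Vector_Spaces.linear_iff vec.vector_space_axioms hat_vec_eq_iff nth ext_scale_def
        \<kappa>_add \<kappa>_sc functional_eq algebra_simps)
  have "\<phi> u = \<phi> u' \<Longrightarrow> u = u'" for u u'
    using c \<kappa>_inj by (cases swap) (auto simp: hat_vec_eq_iff nth prod_eq_iff h_vec_eq_iff functional_eq)
  then have "inj \<phi>" by (rule injI)
  moreover have "surj \<phi>"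
  proof (rule surjI)
    fix z :: "complex ^ hat_index"
    define x :: "complex ^ h_index" where "x = (\<chi> i. case i of
        E1 \<Rightarrow> if swap then z$F2 else z$F1
      | E2 \<Rightarrow> if swap then z$F1 else z$F2
      | E3 \<Rightarrow> if swap then - z$F3 else z$F3
      | X1 \<Rightarrow> if swap then z$Y2 else z$Y1
      | X2 \<Rightarrow> if swap then z$Y1 else z$Y2)"
    show "\<phi> (x, sh (z$F4 / c + functional f x) e) = z"
      using c by (simp add: hat_vec_eq_iff nth \<kappa>) (simp add: x_def)
  qed
  ultimately have "bij \<phi>" by (rule bijI)
  moreover have "\<phi> (ext_bracket H_bracket \<omega> l r u u') = hat_bracket n (\<phi> u) (\<phi> u')" for u u'
  proof -
    have "\<phi> (ext_bracket H_bracket \<omega> l r u u') $ F4 = hat_bracket n (\<phi> u) (\<phi> u') $ F4"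
      unfolding \<phi>_def[of u] \<phi>_def[of u'] hom4[symmetric]
      by (simp add: nth ext_bracket_def \<kappa>_add l r w coboundary_def algebra_simps)
    \<comment> \<open>The remaining coordinates see only the bracket of \<open>H\<close>, which the
      swap preserves.\<close>
    then show ?thesis
      by (cases swap) (simp_all add: hat_vec_eq_iff, simp_all add: hat_bracket_nth nth ext_bracket_def H_bracket_nth algebra_simps)
  qed
  ultimately show ?thesis
    unfolding leibniz_isomorphic_def using lin by blast
qed

proposition nonsplit_extension_isomorphic:
  fixes sh :: "complex \<Rightarrow> 'h::ab_group_add \<Rightarrow> 'h"
  assumes h: "vector_space sh" "e \<noteq> 0" "module.span sh {e} = UNIV"
    and rep: "leibniz_representation (*s) H_bracket sh l r"
    and ker: "H_N \<subseteq> action_kernel l \<inter> action_kernel r"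
      "\<not> (action_kernel l = UNIV \<and> action_kernel r = UNIV)"
    and coc: "leibniz_cocycle (*s) H_bracket sh l r \<omega>"
    and nonsplit: "\<not> leibniz_coboundary (*s) H_bracket sh l r \<omega>"
  shows "\<exists>n. leibniz_isomorphic (ext_scale (*s) sh) (ext_bracket H_bracket \<omega> l r) (*s) (hat_bracket n)"
proof -
  interpret sh: vector_space sh by fact
  obtain \<kappa> where \<kappa>: "Vector_Spaces.linear sh (*) \<kappa>" "\<And>a. sh (\<kappa> a) e = a" "\<And>k. \<kappa> (sh k e) = k"
    using one_dimensional_coordinate[OF h] by blast
  interpret \<kappa>: Vector_Spaces.linear sh "(*)" \<kappa> by (rule \<kappa>)
  note \<kappa>_simps = \<kappa>.add \<kappa>.diff \<kappa>.neg \<kappa>.zero \<kappa>.scale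
  have \<kappa>_inj: "\<kappa> a = \<kappa> b \<Longrightarrow> a = b" for a b
    using \<kappa>(2) by metis
  have \<kappa>e: "\<kappa> e = 1"
    using \<kappa>(3)[of 1] by simp
  obtain \<sigma> where l: "\<And>x a. \<kappa> (l x a) = torus_functional \<sigma> x * \<kappa> a"
    by (rule action_scalar[OF \<kappa>(1,2), of l]) (use rep ker in \<open>auto simp: leibniz_representation_def\<close>)
  obtain \<rho> where r: "\<And>x a. \<kappa> (r x a) = torus_functional \<rho> x * \<kappa> a"
    by (rule action_scalar[OF \<kappa>(1,2), of r]) (use rep ker in \<open>auto simp: leibniz_representation_def\<close>)
  \<comment> \<open>This is the axiom \<open>l_x l_y = - l_x r_y\<close> read in the coordinate of
    the line.\<close>
  have "torus_functional \<sigma> x * (torus_functional \<sigma> y + torus_functional \<rho> y) = 0" for x y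
  proof -
    have "l x (l y e) = - l x (r y e)"
      using rep by (auto simp: leibniz_representation_def)
    then have "\<kappa> (l x (l y e)) = \<kappa> (- l x (r y e))" by simp
    then show ?thesis
      by (simp add: \<kappa>_simps \<kappa>e l r algebra_simps add_eq_0_iff2)
  qed
  from this[of "bas X1" "bas X1"] this[of "bas X1" "bas X2"] this[of "bas X2" "bas X1"] this[of "bas X2" "bas X2"]
  have type: "\<sigma> = 0 \<or> \<sigma> = - \<rho>"
    by (auto simp: torus_functional_bas prod_eq_iff add_eq_0_iff2)
  \<comment> \<open>If \<open>\<rho>\<close> vanished, so would \<open>\<sigma>\<close>, and both
    actions would be zero.\<close>
  have \<rho>: "\<rho> \<noteq> 0"
  proof
    assume "\<rho> = 0"
    with type have "\<kappa> (l x a) = \<kappa> 0" "\<kappa> (r x a) = \<kappa> 0" for x a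
      by (auto simp: l r torus_functional_def \<kappa>_simps)
    then have "l x a = 0" "r x a = 0" for x a
      using \<kappa>_inj by blast+
    then show False using ker(2) by (auto simp: action_kernel_def)
  qed
  define w where "w x y = \<kappa> (\<omega> x y)" for x y
  interpret scalar_cocycle \<sigma> \<rho> w
  proof
    show "bilinear_map (*s) (*) w"
      using coc \<kappa>(1) unfolding w_def
      by (auto simp: leibniz_cocycle_def bilinear_map_def Vector_Spaces.linear_iff)
    fix x y z
    have "\<omega> (H_bracket x y) z - \<omega> x (H_bracket y z) - \<omega> (H_bracket x z) y
             - l x (\<omega> y z) - r y (\<omega> x z) + r z (\<omega> x y) = 0"
      using coc unfolding leibniz_cocycle_def by blast
    from arg_cong[OF this, of \<kappa>]
    show "w (H_bracket x y) z - w x (H_bracket y z) - w (H_bracket x z) y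
      - torus_functional \<sigma> x * w y z - torus_functional \<rho> y * w x z + torus_functional \<rho> z * w x y = 0"
      by (simp only: \<kappa>_simps l r w_def)
  qed
  have "splits_or_realized \<sigma> \<rho> w"
    using type classify_left_zero classify_antisymmetric \<rho> by blast
  moreover have "\<not> cohomologous \<sigma> \<rho> w (\<lambda>x y. 0)"
  proof
    assume "cohomologous \<sigma> \<rho> w (\<lambda>x y. 0)"
    then obtain f where f: "\<And>x y. \<kappa> (\<omega> x y) = coboundary \<sigma> \<rho> f x y"
      by (auto simp: cohomologous_def w_def)
    define g where "g x = sh (functional f x) e" for x
    have "Vector_Spaces.linear (*s) sh g"
      using linear_functional[of f] vec.vector_space_axioms h(1)
      by (simp add: Vector_Spaces.linear_iff g_def sh.scale_left_distrib)
    moreover have "\<omega> x y = g (H_bracket x y) - l x (g y) - r y (g x)" for x y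
      by (rule \<kappa>_inj) (simp add: \<kappa>_simps \<kappa>e l r g_def f coboundary_def)
    ultimately show False using nonsplit unfolding leibniz_coboundary_def by blast
  qed
  ultimately obtain v c swap n where "cohomologous \<sigma> \<rho> w v" and re: "realizes \<sigma> \<rho> v c swap n"
    by (auto simp: splits_or_realized_def)
  then obtain f where "\<And>x y. \<kappa> (\<omega> x y) = coboundary \<sigma> \<rho> f x y + v x y"
    by (auto simp: cohomologous_def w_def)
  from isomorphic_if_realized[OF \<kappa> l r this re] show ?thesis by blast
qed

section \<open>Pairwise non-isomorphism\<close>

text \<open>For a Leibniz algebra this says that it is not a Lie algebra.\<close>

definition square_nonzero :: "('a::ab_group_add \<Rightarrow> 'a \<Rightarrow> 'a) \<Rightarrow> bool"
  where "square_nonzero br \<longleftrightarrow> (\<exists>u. br u u \<noteq> 0)"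

definition derived_square_nonzero :: "('a::ab_group_add \<Rightarrow> 'a \<Rightarrow> 'a) \<Rightarrow> bool"
  where "derived_square_nonzero br \<longleftrightarrow> (\<exists>p q. br (br p q) (br p q) \<noteq> 0)"

text \<open>Tells a hyperbolic plane from a form of rank one: squaring products gives
  \<open>2 u1 u2 e4\<close> in \<open>Hat3\<close> and \<open>u1^2 e4\<close> in
  \<open>Hat2\<close>.\<close>

definition derived_isotropic_pair :: "('a::ab_group_add \<Rightarrow> 'a \<Rightarrow> 'a) \<Rightarrow> bool"
  where "derived_isotropic_pair br \<longleftrightarrow> (\<exists>p q p' q'.
    br (br p q) (br p q) = 0 \<and> br (br p' q') (br p' q') = 0 \<and>
    br (br p q) (br p' q') + br (br p' q') (br p q) \<noteq> 0)"

definition derived_not_two_step :: "('a::ab_group_add \<Rightarrow> 'a \<Rightarrow> 'a) \<Rightarrow> bool"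
  where "derived_not_two_step br \<longleftrightarrow>
    (\<exists>p q p' q' p'' q''. br (br (br p q) (br p' q')) (br p'' q'') \<noteq> 0)"

lemma ex_surj: "surj \<phi> \<Longrightarrow> (\<exists>y. P y) \<longleftrightarrow> (\<exists>x. P (\<phi> x))"
  by (metis surj_def)

text \<open>The invariants are existential statements about brackets, sums and being zero.
  Surjectivity moves the quantifiers to the source, and injectivity preserves being nonzero.\<close>

lemma isomorphic_invariants:
  assumes "leibniz_isomorphic s br s' br'"
  shows "square_nonzero br \<longleftrightarrow> square_nonzero br'"
    and "derived_square_nonzero br \<longleftrightarrow> derived_square_nonzero br'"
    and "derived_isotropic_pair br \<longleftrightarrow> derived_isotropic_pair br'"
    and "derived_not_two_step br \<longleftrightarrow> derived_not_two_step br'"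
proof -
  obtain \<phi> where \<phi>: "Vector_Spaces.linear s s' \<phi>" "bij \<phi>"
    and hom: "\<And>x y. br' (\<phi> x) (\<phi> y) = \<phi> (br x y)"
    using assms by (auto simp: leibniz_isomorphic_def)
  have surj: "surj \<phi>"
    using \<phi>(2) by (rule bij_is_surj)
  interpret Vector_Spaces.linear s s' \<phi> by (rule \<phi>)
  have zero_iff: "\<phi> x = 0 \<longleftrightarrow> x = 0" for x
    using injD[OF bij_is_inj[OF \<phi>(2)], of x 0] zero by auto
  note simps = ex_surj[OF surj] hom add[symmetric] zero_iff
  show "square_nonzero br \<longleftrightarrow> square_nonzero br'"
    by (simp only: square_nonzero_def simps)
  show "derived_square_nonzero br \<longleftrightarrow> derived_square_nonzero br'"
    by (simp only: derived_square_nonzero_def simps)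
  show "derived_isotropic_pair br \<longleftrightarrow> derived_isotropic_pair br'"
    by (simp only: derived_isotropic_pair_def simps)
  show "derived_not_two_step br \<longleftrightarrow> derived_not_two_step br'"
    by (simp only: derived_not_two_step_def simps)
qed

section \<open>Values of the invariants on the six families\<close>

lemma hat_bracket_bas: "hat_bracket n (bas i) (bas j) = hat_table n i j"
  by (cases n; cases i; cases j; simp add: hat_vec_eq_iff hat_bracket_nth axis_def)

lemma square_nonzero_hat:
  "square_nonzero (hat_bracket n) \<longleftrightarrow> n \<in> {Hat1, Hat2, Hat3}"
proof (cases "n \<in> {Hat1, Hat2, Hat3}")
  case True
  \<comment> \<open>One witness for three algebras: the coordinate \<open>F4\<close> comes from
    \<open>[x2,e1]\<close> in \<open>Hat1\<close>, from \<open>[e1,e1]\<close> in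
    \<open>Hat2\<close>, and from \<open>[e1,e2] + [e2,e1]\<close> in \<open>Hat3\<close>.\<close>
  have "hat_bracket n (bas F1 + bas F2 + bas Y2) (bas F1 + bas F2 + bas Y2) $ F4 \<noteq> 0"
    using True by (auto simp: hat_bracket_nth axis_def)
  with True show ?thesis
    by (metis square_nonzero_def zero_index)
next
  case False
  then show ?thesis
    by (cases n) (auto simp: square_nonzero_def hat_vec_eq_iff hat_bracket_nth)
qed

lemma derived_square_nonzero_hat:
  "derived_square_nonzero (hat_bracket n) \<longleftrightarrow> n \<in> {Hat2, Hat3}"
proof (cases "n \<in> {Hat2, Hat3}")
  case True
  \<comment> \<open>In both algebras this product is \<open>e1 + e2\<close>.\<close>
  let ?u = "hat_bracket n (bas F1 + bas F2) (bas Y1 + bas Y2)"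
  have "hat_bracket n ?u ?u $ F4 \<noteq> 0"
    using True by (auto simp: hat_bracket_nth axis_def)
  with True show ?thesis
    by (metis derived_square_nonzero_def zero_index)
next
  case False
  then show ?thesis
    by (cases n) (auto simp: derived_square_nonzero_def hat_vec_eq_iff hat_bracket_nth)
qed

lemma derived_isotropic_pair_hat:
  "derived_isotropic_pair (hat_bracket Hat3)" "\<not> derived_isotropic_pair (hat_bracket Hat2)"
proof -
  show "derived_isotropic_pair (hat_bracket Hat3)"
    unfolding derived_isotropic_pair_def
    by (rule exI[of _ "bas F1"], rule exI[of _ "bas Y1"], rule exI[of _ "bas F2"], rule exI[of _ "bas Y2"])
      (simp add: hat_vec_eq_iff hat_bracket_nth axis_def)
  show "\<not> derived_isotropic_pair (hat_bracket Hat2)"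
    by (auto simp: derived_isotropic_pair_def hat_vec_eq_iff hat_bracket_nth)
qed

lemma derived_not_two_step_hat:
  "derived_not_two_step (hat_bracket Hat6)" "\<not> derived_not_two_step (hat_bracket Hat4)"
  "\<not> derived_not_two_step (hat_bracket (Hat5 \<delta>))"
proof -
  \<comment> \<open>This is \<open>[[e1,e2],e1] = -e4\<close>, with \<open>e1 = [e1,x1]\<close> and
    \<open>e2 = [e2,x2]\<close> written as products.\<close>
  have "hat_bracket Hat6 (hat_bracket Hat6 (hat_bracket Hat6 (bas F1) (bas Y1)) (hat_bracket Hat6 (bas F2) (bas Y2)))
    (hat_bracket Hat6 (bas F1) (bas Y1)) $ F4 \<noteq> 0"
    by (simp add: hat_bracket_nth axis_def)
  then show "derived_not_two_step (hat_bracket Hat6)"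
    by (metis derived_not_two_step_def zero_index)
qed (auto simp: derived_not_two_step_def hat_vec_eq_iff hat_bracket_nth)

text \<open>For \<open>Hat4\<close> and \<open>Hat5 \<delta>\<close> the entries are the
  coefficients of \<open>e4\<close> in \<open>[e1,x1]\<close> and \<open>[e1,x2]\<close>.\<close>

definition twist :: "hat_name \<Rightarrow> complex \<times> complex"
  where "twist n = (case n of Hat4 \<Rightarrow> (1, 0) | Hat5 \<delta> \<Rightarrow> (\<delta>, 1) | _ \<Rightarrow> 0)"

text \<open>
  In \<open>Hat4\<close> and \<open>Hat5 \<delta>\<close> the torus acts on \<open>\<langle>e1, e4\<rangle>\<close> by a Jordan block whose nilpotent part is
  a linear functional \<open>twist\<close> of the torus element; isomorphisms preserve the torus weights,
  and therefore this functional up to a scalar.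
\<close>
lemma twist_proportional:
  assumes iso: "leibniz_isomorphic (*s) (hat_bracket m) (*s) (hat_bracket n)"
    and m: "m = Hat4 \<or> m = Hat5 \<delta>" and n: "n = Hat4 \<or> n = Hat5 \<delta>'"
  shows "fst (twist m) * snd (twist n) = snd (twist m) * fst (twist n)"
proof -
  obtain \<phi> where \<phi>: "Vector_Spaces.linear (*s) (*s) \<phi>" "bij \<phi>"
    and hom: "\<And>x y. \<phi> (hat_bracket m x y) = hat_bracket n (\<phi> x) (\<phi> y)"
    using iso by (auto simp: leibniz_isomorphic_def)
  interpret Vector_Spaces.linear "(*s)" "(*s)" \<phi> by (rule \<phi>)
  have inj: "\<phi> x = \<phi> y \<Longrightarrow> x = y" for x y
    using bij_is_inj[OF \<phi>(2)] by (rule injD)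
  obtain p q where pq: "twist m = (p, q)" by fastforce
  obtain p' q' where pq': "twist n = (p', q')" by fastforce
  have pq0: "p \<noteq> 0 \<or> q \<noteq> 0"
    using m pq by (auto simp: twist_def)
  note nth = hat_bracket_nth(1-3,5,6)[of n]
  have nth4: "hat_bracket n u v $ F4 = p' * (u$F1 * v$Y1 - u$Y1 * v$F1) + q' * (u$F1 * v$Y2 - u$Y2 * v$F1)
      + u$F4 * v$Y1 - u$Y1 * v$F4" for u v
    using n pq' by (auto simp: hat_bracket_nth twist_def algebra_simps)
  have br: "hat_bracket m (bas F1) (bas F2) = bas F3"
    "hat_bracket m (bas F1) (bas Y1) = bas F1 + p *s bas F4"
    "hat_bracket m (bas F1) (bas Y2) = q *s bas F4"
    "hat_bracket m (bas F2) (bas Y2) = bas F2"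
    "hat_bracket m (bas F3) (bas Y1) = bas F3"
    "hat_bracket m (bas F3) (bas Y2) = bas F3"
    "hat_bracket m (bas F4) (bas Y1) = bas F4"
    "hat_bracket m (bas F4) (bas Y2) = 0"
    using m pq by (auto simp: hat_bracket_bas twist_def)
  define u1 u2 u3 w y1 y2 where u: "u1 = \<phi> (bas F1)" "u2 = \<phi> (bas F2)" "u3 = \<phi> (bas F3)"
    "w = \<phi> (bas F4)" "y1 = \<phi> (bas Y1)" "y2 = \<phi> (bas Y2)"
  have e: "hat_bracket n u1 u2 = u3" "hat_bracket n u1 y1 = u1 + p *s w" "hat_bracket n u1 y2 = q *s w"
    "hat_bracket n u2 y2 = u2" "hat_bracket n u3 y1 = u3" "hat_bracket n u3 y2 = u3"
    "hat_bracket n w y1 = w" "hat_bracket n w y2 = 0"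
    using hom[of "bas F1" "bas F2"] hom[of "bas F1" "bas Y1"] hom[of "bas F1" "bas Y2"]
      hom[of "bas F2" "bas Y2"] hom[of "bas F3" "bas Y1"] hom[of "bas F3" "bas Y2"]
      hom[of "bas F4" "bas Y1"] hom[of "bas F4" "bas Y2"]
    by (simp_all add: br u add scale zero)
  have wY: "w$Y1 = 0" "w$Y2 = 0"
    using arg_cong[OF e(7), of "\<lambda>v. v$Y1"] arg_cong[OF e(7), of "\<lambda>v. v$Y2"] by (simp_all add: nth)
  have u1Y: "u1$Y1 = 0" "u1$Y2 = 0"
    using arg_cong[OF e(2), of "\<lambda>v. v$Y1"] arg_cong[OF e(2), of "\<lambda>v. v$Y2"] by (simp_all add: nth wY)
  have u2Y: "u2$Y1 = 0" "u2$Y2 = 0"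
    using arg_cong[OF e(4), of "\<lambda>v. v$Y1"] arg_cong[OF e(4), of "\<lambda>v. v$Y2"] by (simp_all add: nth)
  \<comment> \<open>\<open>u3\<close> is the product of two vectors without torus part, hence a
    multiple of \<open>e3\<close>.\<close>
  have u3: "u3$F1 = 0" "u3$F2 = 0" "u3$F4 = 0" "u3$Y1 = 0" "u3$Y2 = 0"
    unfolding e(1)[symmetric] by (simp_all add: nth nth4 u1Y u2Y)
  have "u3 \<noteq> 0"
    using inj[of "bas F3" 0] by (auto simp: u zero)
  then have u33: "u3$F3 \<noteq> 0"
    using u3 by (simp add: hat_vec_eq_iff)
  \<comment> \<open>Otherwise \<open>y1\<close> and \<open>y2\<close> would act on this coordinate
    by the scalars 1 and 0. Then \<open>[u1,y1] = u1 + p w\<close> and \<open>[u1,y2] = q w\<close>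
    would give \<open>p = q = 0\<close>. The coordinate \<open>F2\<close> is treated alike.\<close>
  have w1: "w$F1 = 0"
  proof (rule ccontr)
    assume a: "w$F1 \<noteq> 0"
    have "y1$Y1 = 1" "y2$Y1 = 0"
      using arg_cong[OF e(7), of "\<lambda>v. v$F1"] arg_cong[OF e(8), of "\<lambda>v. v$F1"] a by (simp_all add: nth wY)
    then show False
      using arg_cong[OF e(2), of "\<lambda>v. v$F1"] arg_cong[OF e(3), of "\<lambda>v. v$F1"] a pq0 by (simp add: nth u1Y)
  qed
  have w2: "w$F2 = 0"
  proof (rule ccontr)
    assume a: "w$F2 \<noteq> 0"
    have "y1$Y2 = 1" "y2$Y2 = 0"
      using arg_cong[OF e(7), of "\<lambda>v. v$F2"] arg_cong[OF e(8), of "\<lambda>v. v$F2"] a by (simp_all add: nth wY)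
    then show False
      using arg_cong[OF e(2), of "\<lambda>v. v$F2"] arg_cong[OF e(3), of "\<lambda>v. v$F2"] a pq0 by (simp add: nth u1Y)
  qed
  \<comment> \<open>Otherwise \<open>w\<close> and \<open>u3\<close> would both be multiples of
    \<open>e3\<close>, against injectivity.\<close>
  have w4: "w$F4 \<noteq> 0"
  proof
    assume "w$F4 = 0"
    then have "\<phi> (w$F3 *s bas F3) = \<phi> (u3$F3 *s bas F4)"
      using u3 w1 w2 wY by (simp add: scale u(3,4)[symmetric] hat_vec_eq_iff)
    then have "w$F3 *s bas F3 = u3$F3 *s bas F4"
      by (rule inj)
    then show False
      using u33 by (simp add: hat_vec_eq_iff axis_def)
  qed
  \<comment> \<open>The actions on \<open>w\<close> and then on \<open>u3\<close> show that
    \<open>y1\<close> and \<open>y2\<close> agree with \<open>x1\<close> and \<open>x2\<close>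
    modulo the nilradical.\<close>
  have a: "y1$Y1 = 1" "y2$Y1 = 0"
    using arg_cong[OF e(7), of "\<lambda>v. v$F4"] arg_cong[OF e(8), of "\<lambda>v. v$F4"] w4 by (simp_all add: nth4 wY w1)
  have b: "y1$Y2 = 0" "y2$Y2 = 1"
    using arg_cong[OF e(5), of "\<lambda>v. v$F3"] arg_cong[OF e(6), of "\<lambda>v. v$F3"] u33 by (simp_all add: nth u3 a)
  \<comment> \<open>The \<open>F4\<close> coordinates of \<open>[u1,y1]\<close> and
    \<open>[u1,y2]\<close> relate the two twists by the common factors \<open>u1$F1\<close> and
    \<open>w$F4\<close>.\<close>
  have "p' * u1$F1 = p * w$F4" "q' * u1$F1 = q * w$F4"
    using arg_cong[OF e(2), of "\<lambda>v. v$F4"] arg_cong[OF e(3), of "\<lambda>v. v$F4"] by (simp_all add: nth4 u1Y a b)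
  then have "(p * q') * w$F4 = (q * p') * w$F4"
    by algebra
  then show ?thesis
    using w4 by (simp add: pq pq')
qed

text \<open>Squares separate \<open>Hat1\<close>, \<open>Hat2\<close>, \<open>Hat3\<close> from the
  rest; squares of products then isolate \<open>Hat1\<close>, and isotropic pairs tell
  \<open>Hat2\<close> from \<open>Hat3\<close>. Triple products of derived elements isolate
  \<open>Hat6\<close>. Within \<open>Hat4\<close> and \<open>Hat5\<close> the twists
  \<open>(1,0)\<close> and \<open>(\<delta>,1)\<close> are pairwise non-proportional.\<close>

lemma hat_not_isomorphic:
  assumes "m \<noteq> n"
  shows "\<not> leibniz_isomorphic (*s) (hat_bracket m) (*s) (hat_bracket n)"
proof
  assume iso: "leibniz_isomorphic (*s) (hat_bracket m) (*s) (hat_bracket n)"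
  note inv = isomorphic_invariants[OF iso]
  have twist: "fst (twist m) * snd (twist n) = snd (twist m) * fst (twist n)"
    if "m = Hat4 \<or> (\<exists>\<delta>. m = Hat5 \<delta>)" "n = Hat4 \<or> (\<exists>\<delta>. n = Hat5 \<delta>)"
    using that twist_proportional[OF iso] by blast
  show False
    using assms inv twist
    by (cases m; cases n)
      (auto simp: square_nonzero_hat derived_square_nonzero_hat derived_isotropic_pair_hat
        derived_not_two_step_hat twist_def)
qed

theorem theorem4p5:
  fixes sh :: "complex \<Rightarrow> 'h::ab_group_add \<Rightarrow> 'h" and e4 :: 'h
  shows
    "(\<forall>l r \<omega>.
        vector_space sh \<and> e4 \<noteq> 0 \<and> module.span sh {e4} = UNIV \<and>
        leibniz_representation (*s) H_bracket sh l r \<and>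
        H_N \<subseteq> action_kernel l \<inter> action_kernel r \<and>
        \<not> (action_kernel l = UNIV \<and> action_kernel r = UNIV) \<and>
        leibniz_cocycle (*s) H_bracket sh l r \<omega> \<and>
        \<not> leibniz_coboundary (*s) H_bracket sh l r \<omega> \<longrightarrow>
        (\<exists>n. leibniz_isomorphic (ext_scale (*s) sh) (ext_bracket H_bracket \<omega> l r)
                (*s) (hat_bracket n)))
     \<and> (\<forall>m n. m \<noteq> n \<longrightarrow> \<not> leibniz_isomorphic (*s) (hat_bracket m) (*s) (hat_bracket n))"
  using nonsplit_extension_isomorphic[of sh e4] hat_not_isomorphic by blast

end
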